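(* If $G$ is of type $A$ and $X=\amalg_P G/P$ is the total flag variety (disjoint union over all standard parabolic subgroups $P$), then there is a ring isomorphism $$(\Gamma(\mathcal{O}),\circ)\simeq\operatorname{End}_{\mathfrak{M}_T^W}([X]),$$ where $\mathcal{O}=\bigoplus_{P,Q}{}^Q\mathcal{O}^P$ is the total double structure $\mathtt{h}$-sheaf of $G$, $\circ$ is the correspondence product, and $[X]$ is the $W$-invariant equivariant $\mathtt{h}$-motive of $X$.
   Context: **Groups.** $k$ is a field of characteristic $0$; $G$ is a split semisimple linear algebraic group over $k$ with split maximal torus $T$, character group $T^*$, Borel subgroup $B\supseteq T$, root system $\Sigma=\Sigma^+\amalg\Sigma^-$, simple roots $\Theta$, Weyl group $W$. Standard parabolics $P\supseteq B$ correspond to subsets $\Theta_P\subseteq\Theta$; $\Sigma_P^+$ is the set of positive roots of the subsystem generated by $\Theta_P$; $W_P$ is generated by the simple reflections in $\Theta_P$. **Cohomology.** $\mathtt{h}(-)=\Omega(-)\otimes_{\mathbb{L}}R$ is an algebraic oriented cohomology theory (Levine–Morel) with formal group law $F$ over $R=\mathtt{h}(pt)$; $\mathtt{h}_T(X)=\varprojlim_i\mathtt{h}(X\times^TU_i)$ is its $T$-equivariant version (Borel construction). Theories are Chern-complete: $S=\mathtt{h}_T(pt)$ is identified with $R[[x_\lambda]]_{\lambda\in T^*}/J$ (with $R[x_\lambda]_{\lambda\in T^*}/J$ if $F$ is a polynomial), $J$ being the closure of the ideal of relations $x_0=0$, $x_{\lambda+\mu}=F(x_\lambda,x_\mu)$,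 and $x_\lambda=c_1^{\mathtt{h}}(\mathcal{L}_\lambda)$. $S$ is assumed $\Sigma$-regular: each $x_\alpha$, $\alpha\in\Sigma$, is a non-zero-divisor. $W$ acts on $S$ by $w(x_\lambda)=x_{w(\lambda)}$ and on $\mathtt{h}_T(X)$, for a $G$-variety $X$, via the right action $(v,x)T\cdot\sigma T=(v\sigma,\sigma^{-1}x)T$, $\sigma\in N_G(T)$, on the Borel construction $V\times^TX$; $\mathtt{h}_T(X)^W$ denotes invariants. $G$ acts diagonally on products. **Motives.** For standard parabolics $Q,P,H$, the correspondence product $$\mathtt{h}_T(G/Q\times G/P)^W\otimes\mathtt{h}_T(G/P\times G/H)^W\to\mathtt{h}_T(G/Q\times G/H)^W,\quad (\phi,\psi)\mapsto\psi\circ\phi=pr_{Q,H*}\big(pr_{P,H}^*(\psi)\cdot pr_{Q,P}^*(\phi)\big),$$ uses the projections from $G/Q\times G/P\times G/H$. $\mathfrak{M}_T^W$ is the additive category of $W$-invariant equivariant $\mathtt{h}$-motives generated by the motives $[G/P]$ of the varieties $G/P$, with morphism groups $\operatorname{Hom}([X],[Y])=\mathtt{h}_T(X\times Y)^W$ and composition the correspondence product; $[\amalg_PG/P]=\bigoplus_P[G/P]$. **Double moment graphs.** $W^P$ and ${}^QW^P$ are the sets of minimal length representatives of $W/W_P$ and $W_Q\backslash W/W_P$; $\widehat w\in{}^QW^P$ is the minimal representative of $W_QwW_P$; $\le$ is the Bruhat order. For $u\in{}^QW^P$, $W_u$ is generated by the reflections $s_\alpha$, $\alpha\in\Theta_u=\Theta_Q\cap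 u(\Sigma_P^+)$, and $W_Q^u$ is the set of minimal length representatives of $W_Q/W_u$. A double moment graph ${}^Q\mathcal{G}^P$ has vertex set ${}^QW^P$ and an edge $u\to u'$ whenever $u\ne u'$ and $u'=\widehat{s_\beta u}$ for some $\beta\in\Sigma^+$ with $u\le s_\beta u$; for each edge one such $\beta$ is chosen as its label $l(u\to u')$. **Structure sheaves.** The double structure $\mathtt{h}$-sheaf ${}^Q\mathcal{O}^P$ on ${}^Q\mathcal{G}^P$ has global sections $\Gamma({}^Q\mathcal{O}^P)$ equal to the set of $(c_u)\in\prod_{u\in{}^QW^P}S^{W_u}$ such that for every edge $u\to u'$ with label $\alpha$ one has $c_u-w(c_{u'})\in x_\alpha S$, where $w\in W_Q^{u'}$ is the unique element with $s_\alpha u\in wu'W_P$. Set $\Gamma(\mathcal{O})=\bigoplus_{P,Q}\Gamma({}^Q\mathcal{O}^P)$, over all pairs of standard parabolics. For $G$ of type $A$ the module $\Gamma({}^Q\mathcal{O}^P)$ is identified with $\mathtt{h}_T(G/Q\times G/P)^W$ (a $W$-invariant class $a$ corresponds to the tuple $(c_u)$ where $c_u\in S$ is the restriction of $a$ to the $T$-fixed point $(eQ,uP)$), and the product $\circ$ on $\Gamma(\mathcal{O})$ is the correspondence product transported through these identifications (products of non-composable components being $0$). *)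

theory Defs
  imports
    "HOL-Algebra.Algebra"
    "HOL-Algebra.Algebraic_Closure_Type"
    "HOL-Library.Poly_Mapping"
    "HOL-Library.FuncSet"
begin

no_notation var (\<open>X\<index>\<close>)
no_notation phi' (\<open>\<phi> _\<close>)

section \<open>Varieties over a field of characteristic 0\<close>

text \<open>
  Over a field \<open>k\<close> of characteristic 0, reduced quasi-projective \<open>k\<close>-schemes are the same thing as
  \<open>k\<close>-locally closed subsets of products of projective spaces over the algebraic closure \<open>K\<close> of
  \<open>k\<close>, with maps given locally by forms with coefficients in \<open>k\<close> as morphisms. Smooth
  schemes are reduced, and products of reduced schemes are reduced in characteristic 0, so this
  language suffices here.

  A point of \<open>P^(n_1) x ... x P^(n_r)\<close> is a list of \<open>r\<close> coordinate vectors, each normalized so that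
  its first nonzero entry is 1. Products of varieties are then obtained by appending lists,
  the one-point variety is \<open>{[]}\<close>, and a point is \<open>k\<close>-rational iff its coordinates are in \<open>k\<close>.
\<close>

type_synonym 'k pt = "'k alg_closure list list"
type_synonym 'k mpoly = "(nat \<times> nat, nat) poly_mapping \<Rightarrow>\<^sub>0 'k alg_closure"

record (overloaded) 'k variety =
  dims :: "nat list"
  pts :: "'k pt set"

definition base_field :: "'k::field alg_closure set" where
  "base_field = range to_ac"

text \<open>The variable \<open>(i, j)\<close> is the \<open>j\<close>-th homogeneous coordinate of the \<open>i\<close>-th factor.\<close>

definition peval :: "'k::field mpoly \<Rightarrow> 'k pt \<Rightarrow> 'k alg_closure" where
  "peval p x = (\<Sum>m\<in>Poly_Mapping.keys p. Poly_Mapping.lookup p m * (\<Prod>v\<in>Poly_Mapping.keys m. (x ! fst v ! snd v) ^ Poly_Mapping.lookup m v))"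

definition partial_eval :: "'k::field mpoly \<Rightarrow> nat \<times> nat \<Rightarrow> 'k pt \<Rightarrow> 'k alg_closure" where
  "partial_eval p v x = (\<Sum>m\<in>Poly_Mapping.keys p. Poly_Mapping.lookup p m * of_nat (Poly_Mapping.lookup m v) *
     (\<Prod>w\<in>Poly_Mapping.keys m. (x ! fst w ! snd w) ^ (Poly_Mapping.lookup m w - (if w = v then 1 else 0))))"

definition form :: "'k::field alg_closure set \<Rightarrow> nat list \<Rightarrow> (nat \<Rightarrow> nat) \<Rightarrow> 'k mpoly \<Rightarrow> bool" where
  "form F ns d p \<longleftrightarrow> (\<forall>m\<in>Poly_Mapping.keys p. Poly_Mapping.lookup p m \<in> F \<and>
     (\<forall>v\<in>Poly_Mapping.keys m. fst v < length ns \<and> snd v \<le> ns ! fst v) \<and>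
     (\<forall>i<length ns. (\<Sum>v | v \<in> Poly_Mapping.keys m \<and> fst v = i. Poly_Mapping.lookup m v) = d i))"

definition normalized :: "'k::field alg_closure list \<Rightarrow> bool" where
  "normalized a \<longleftrightarrow> (\<exists>j<length a. a ! j = 1 \<and> (\<forall>i<j. a ! i = 0))"

definition mproj :: "nat list \<Rightarrow> 'k::field pt set" where
  "mproj ns = {x. length x = length ns \<and>
     (\<forall>i<length ns. length (x ! i) = Suc (ns ! i) \<and> normalized (x ! i))}"

definition zclosed :: "'k::field alg_closure set \<Rightarrow> nat list \<Rightarrow> 'k pt set \<Rightarrow> bool" where
  "zclosed F ns C \<longleftrightarrow> (\<exists>S. (\<forall>p\<in>S. \<exists>d. form F ns d p) \<and> C = {x \<in> mproj ns. \<forall>p\<in>S. peval p x = 0})"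

definition closed_sub :: "'k::field alg_closure set \<Rightarrow> 'k variety \<Rightarrow> 'k pt set \<Rightarrow> bool" where
  "closed_sub F X C \<longleftrightarrow> (\<exists>D. zclosed F (dims X) D \<and> C = pts X \<inter> D)"

definition open_sub :: "'k::field alg_closure set \<Rightarrow> 'k variety \<Rightarrow> 'k pt set \<Rightarrow> bool" where
  "open_sub F X U \<longleftrightarrow> (\<exists>D. zclosed F (dims X) D \<and> U = pts X - D)"

definition subvar :: "'k variety \<Rightarrow> 'k pt set \<Rightarrow> 'k variety" where
  "subvar X A = X\<lparr>pts := A\<rparr>"

definition is_variety :: "'k::field variety \<Rightarrow> bool" where
  "is_variety X \<longleftrightarrow> (\<exists>C D. zclosed base_field (dims X) C \<and> zclosed base_field (dims X) D \<and> pts X = C - D)"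

definition morph :: "'k::field alg_closure set \<Rightarrow> 'k variety \<Rightarrow> 'k variety \<Rightarrow> ('k pt \<Rightarrow> 'k pt) \<Rightarrow> bool" where
  "morph F X Y f \<longleftrightarrow> f ` pts X \<subseteq> pts Y \<and>
     (\<forall>x\<in>pts X. \<forall>j<length (dims Y). \<exists>d q.
        (\<forall>l\<le>dims Y ! j. form F (dims X) d (q l)) \<and>
        (\<exists>l\<le>dims Y ! j. peval (q l) x \<noteq> 0) \<and>
        (\<forall>y\<in>pts X. (\<exists>l\<le>dims Y ! j. peval (q l) y \<noteq> 0) \<longrightarrow>
           (\<exists>c. \<forall>l\<le>dims Y ! j. peval (q l) y = c * (f y ! j ! l))))"

definition iso_morph :: "'k::field alg_closure set \<Rightarrow> 'k variety \<Rightarrow> 'k variety \<Rightarrow> ('k pt \<Rightarrow> 'k pt) \<Rightarrow> bool" where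
  "iso_morph F X Y f \<longleftrightarrow> morph F X Y f \<and>
     (\<exists>g. morph F Y X g \<and> (\<forall>x\<in>pts X. g (f x) = x) \<and> (\<forall>y\<in>pts Y. f (g y) = y))"

text \<open>
  Jacobian criterion: near each point, \<open>X\<close> is cut out by \<open>c\<close> forms over \<open>k\<close> whose gradients are
  linearly independent at the point.
\<close>

definition smooth :: "'k::field variety \<Rightarrow> bool" where
  "smooth X \<longleftrightarrow> (\<forall>x\<in>pts X. \<exists>(c::nat) g D.
     (\<forall>i<c. \<exists>d. form base_field (dims X) d (g i)) \<and>
     zclosed base_field (dims X) D \<and> x \<notin> D \<and>
     pts X - D = {y \<in> mproj (dims X) - D. \<forall>i<c. peval (g i) y = 0} \<and>
     (\<forall>a. (\<forall>v. (\<Sum>i<c. a i * partial_eval (g i) v x) = 0) \<longrightarrow> (\<forall>i<c. a i = 0)))"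

definition Sm :: "'k::field variety set" where
  "Sm = {X. is_variety X \<and> smooth X}"

definition Pt :: "'k::field variety" where
  "Pt = \<lparr>dims = [], pts = {[]}\<rparr>"

definition avec :: "'k::field alg_closure list \<Rightarrow> 'k pt" where
  "avec a = [1 # a]"

definition affine_space :: "nat \<Rightarrow> 'k::field variety" where
  "affine_space n = \<lparr>dims = [n], pts = {avec a | a. length a = n}\<rparr>"

definition proj_space :: "nat \<Rightarrow> 'k::field variety" where
  "proj_space n = \<lparr>dims = [n], pts = mproj [n]\<rparr>"

definition split_torus :: "nat \<Rightarrow> 'k::field variety" where
  "split_torus r = \<lparr>dims = replicate r 1,
     pts = {map (\<lambda>a. [1, a]) as | as. length as = r \<and> 0 \<notin> set as}\<rparr>"

definition vprod :: "'k::field variety \<Rightarrow> 'k variety \<Rightarrow> 'k variety" where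
  "vprod X Y = \<lparr>dims = dims X @ dims Y, pts = {x @ y | x y. x \<in> pts X \<and> y \<in> pts Y}\<rparr>"

definition prl :: "'k variety \<Rightarrow> 'k pt \<Rightarrow> 'k pt" where
  "prl X p = take (length (dims X)) p"

definition prr :: "'k variety \<Rightarrow> 'k pt \<Rightarrow> 'k pt" where
  "prr X p = drop (length (dims X)) p"

definition fibre_prod ::
  "'k::field variety \<Rightarrow> 'k variety \<Rightarrow> ('k pt \<Rightarrow> 'k pt) \<Rightarrow> ('k pt \<Rightarrow> 'k pt) \<Rightarrow> 'k variety" where
  "fibre_prod X Y f g = subvar (vprod X Y) {x @ y | x y. x \<in> pts X \<and> y \<in> pts Y \<and> f x = g y}"

definition projective_morph :: "'k::field variety \<Rightarrow> 'k variety \<Rightarrow> ('k pt \<Rightarrow> 'k pt) \<Rightarrow> bool" where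
  "projective_morph Y X f \<longleftrightarrow> morph base_field Y X f \<and>
     (\<exists>n i C. closed_sub base_field (vprod X (proj_space n)) C \<and>
        iso_morph base_field Y (subvar (vprod X (proj_space n)) C) i \<and>
        (\<forall>y\<in>pts Y. prl X (i y) = f y))"

definition regular :: "'k::field alg_closure set \<Rightarrow> 'k variety \<Rightarrow> ('k pt \<Rightarrow> 'k alg_closure) \<Rightarrow> bool" where
  "regular F X \<phi> \<longleftrightarrow> morph F X (affine_space 1) (\<lambda>x. avec [\<phi> x])"

text \<open>\<open>\<phi>\<close> represents an element of the square of the maximal ideal of the local ring of
  \<open>X\<close> (over \<open>K\<close>) at \<open>x\<close>.\<close>

definition in_max_ideal_sq :: "'k::field variety \<Rightarrow> 'k pt \<Rightarrow> ('k pt \<Rightarrow> 'k alg_closure) \<Rightarrow> bool" where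
  "in_max_ideal_sq X x \<phi> \<longleftrightarrow> (\<exists>U (n::nat) a b. open_sub UNIV X U \<and> x \<in> U \<and>
     (\<forall>i<n. regular UNIV (subvar X U) (a i) \<and> regular UNIV (subvar X U) (b i) \<and>
            a i x = 0 \<and> b i x = 0) \<and>
     (\<forall>y\<in>U. \<phi> y = (\<Sum>i<n. a i y * b i y)))"

text \<open>
  Levine and Morel call \<open>f: X \<rightarrow> Z\<close> and \<open>g: Y \<rightarrow> Z\<close> in \<open>Sm\<close> transverse if \<open>X\<close> and \<open>Y\<close> are
  Tor-independent over \<open>Z\<close> and the scheme \<open>X \<times>_Z Y\<close> is smooth. As \<open>X\<close>, \<open>Y\<close>, \<open>Z\<close> are smooth, this
  says that \<open>T_x X \<oplus> T_y Y \<rightarrow> T_z Z\<close> is onto wherever \<open>f x = g y = z\<close>, i.e. that the dual map on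
  cotangent spaces \<open>m/m^2\<close> is injective, which is the form used here.
\<close>

definition transverse ::
  "'k::field variety \<Rightarrow> 'k variety \<Rightarrow> 'k variety \<Rightarrow> ('k pt \<Rightarrow> 'k pt) \<Rightarrow> ('k pt \<Rightarrow> 'k pt) \<Rightarrow> bool" where
  "transverse X Y Z f g \<longleftrightarrow> morph base_field X Z f \<and> morph base_field Y Z g \<and>
     fibre_prod X Y f g \<in> Sm \<and>
     (\<forall>x\<in>pts X. \<forall>y\<in>pts Y. f x = g y \<longrightarrow>
        (\<forall>U \<phi>. open_sub UNIV Z U \<and> f x \<in> U \<and> regular UNIV (subvar Z U) \<phi> \<and> \<phi> (f x) = 0 \<and>
               in_max_ideal_sq X x (\<phi> \<circ> f) \<and> in_max_ideal_sq Y y (\<phi> \<circ> g) \<longrightarrow>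
               in_max_ideal_sq Z (f x) \<phi>))"


section \<open>Vector bundles\<close>

record (overloaded) 'k vbundle =
  vtot :: "'k variety"
  vprj :: "'k pt \<Rightarrow> 'k pt"
  vadd :: "'k pt \<Rightarrow> 'k pt \<Rightarrow> 'k pt"
  vscale :: "'k alg_closure \<Rightarrow> 'k pt \<Rightarrow> 'k pt"

definition vchart ::
  "'k::field variety \<Rightarrow> 'k vbundle \<Rightarrow> nat \<Rightarrow> 'k pt set \<Rightarrow> ('k pt \<Rightarrow> 'k pt) \<Rightarrow> bool" where
  "vchart X E n U \<phi> \<longleftrightarrow> open_sub base_field X U \<and>
     iso_morph base_field (vprod (subvar X U) (affine_space n))
       (subvar (vtot E) {e \<in> pts (vtot E). vprj E e \<in> U}) \<phi> \<and>
     (\<forall>x\<in>U. \<forall>a b. length a = n \<and> length b = n \<longrightarrow>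
        vprj E (\<phi> (x @ avec a)) = x \<and>
        vadd E (\<phi> (x @ avec a)) (\<phi> (x @ avec b)) = \<phi> (x @ avec (map2 (+) a b)) \<and>
        (\<forall>c. vscale E c (\<phi> (x @ avec a)) = \<phi> (x @ avec (map ((*) c) a))))"

definition vector_bundle :: "'k::field variety \<Rightarrow> 'k vbundle \<Rightarrow> nat \<Rightarrow> bool" where
  "vector_bundle X E n \<longleftrightarrow> X \<in> Sm \<and> vtot E \<in> Sm \<and> morph base_field (vtot E) X (vprj E) \<and>
     (\<forall>x\<in>pts X. \<exists>U \<phi>. x \<in> U \<and> vchart X E n U \<phi>)"

definition zero_section :: "'k::field vbundle \<Rightarrow> 'k pt \<Rightarrow> 'k pt" where
  "zero_section E x = vscale E 0 (SOME e. e \<in> pts (vtot E) \<and> vprj E e = x)"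

definition tensor_line_bundle ::
  "'k::field variety \<Rightarrow> 'k vbundle \<Rightarrow> 'k vbundle \<Rightarrow> 'k vbundle \<Rightarrow> bool" where
  "tensor_line_bundle X L M N \<longleftrightarrow>
     vector_bundle X L 1 \<and> vector_bundle X M 1 \<and> vector_bundle X N 1 \<and>
     (\<exists>b. morph base_field (fibre_prod (vtot L) (vtot M) (vprj L) (vprj M)) (vtot N)
            (\<lambda>p. b (prl (vtot L) p) (prr (vtot L) p)) \<and>
        (\<forall>l\<in>pts (vtot L). \<forall>l'\<in>pts (vtot L). \<forall>m\<in>pts (vtot M). \<forall>m'\<in>pts (vtot M).
           vprj L l = vprj M m \<and> vprj L l' = vprj M m \<and> vprj M m' = vprj M m \<longrightarrow>
           vprj N (b l m) = vprj M m \<and>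
           b (vadd L l l') m = vadd N (b l m) (b l' m) \<and>
           b l (vadd M m m') = vadd N (b l m) (b l m') \<and>
           (\<forall>c. b (vscale L c l) m = vscale N c (b l m) \<and> b l (vscale M c m) = vscale N c (b l m)) \<and>
           (b l m = zero_section N (vprj M m) \<longrightarrow>
              l = zero_section L (vprj M m) \<or> m = zero_section M (vprj M m))))"

text \<open>
  \<open>q: P \<rightarrow> X\<close> with the line bundle \<open>L\<close> and \<open>ev: q^*E \<rightarrow> L\<close> is the bundle of rank one quotients of
  the vector bundle \<open>E\<close> of rank \<open>n + 1\<close>, with its canonical quotient line bundle \<open>O(1)\<close>: over a chart
  of \<open>E\<close>, the point \<open>[a]\<close> of the fibre is the quotient of \<open>E_x\<close> by the hyperplane \<open>\<Sum> a_j v_j = 0\<close>.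
\<close>

definition projective_bundle ::
  "'k::field variety \<Rightarrow> 'k vbundle \<Rightarrow> nat \<Rightarrow> 'k variety \<Rightarrow> ('k pt \<Rightarrow> 'k pt) \<Rightarrow> 'k vbundle \<Rightarrow> bool" where
  "projective_bundle X E n P q L \<longleftrightarrow>
     vector_bundle X E (Suc n) \<and> vector_bundle P L 1 \<and> morph base_field P X q \<and>
     (\<exists>ev. morph base_field (fibre_prod P (vtot E) q (vprj E)) (vtot L)
             (\<lambda>r. ev (prl P r) (prr P r)) \<and>
        (\<forall>p\<in>pts P. \<forall>e\<in>pts (vtot E). \<forall>e'\<in>pts (vtot E).
           vprj E e = q p \<and> vprj E e' = q p \<longrightarrow>
           vprj L (ev p e) = p \<and> ev p (vadd E e e') = vadd L (ev p e) (ev p e') \<and>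
           (\<forall>c. ev p (vscale E c e) = vscale L c (ev p e))) \<and>
        (\<forall>x\<in>pts X. \<exists>U \<phi> \<psi>. x \<in> U \<and> vchart X E (Suc n) U \<phi> \<and>
           iso_morph base_field (vprod (subvar X U) (proj_space n)) (subvar P {p \<in> pts P. q p \<in> U}) \<psi> \<and>
           (\<forall>y\<in>U. \<forall>a\<in>pts (proj_space n). q (\<psi> (y @ a)) = y \<and>
              (\<forall>v. length v = Suc n \<longrightarrow>
                 (ev (\<psi> (y @ a)) (\<phi> (y @ avec v)) = zero_section L (\<psi> (y @ a)) \<longleftrightarrow>
                  (\<Sum>j\<le>n. a ! 0 ! j * v ! j) = 0)))))"

definition affine_bundle ::
  "'k::field variety \<Rightarrow> 'k vbundle \<Rightarrow> 'k variety \<Rightarrow> ('k pt \<Rightarrow> 'k pt) \<Rightarrow> bool" where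
  "affine_bundle X E V p \<longleftrightarrow> (\<exists>n. vector_bundle X E n) \<and> V \<in> Sm \<and> morph base_field V X p \<and>
     (\<exists>act. morph base_field (fibre_prod V (vtot E) p (vprj E)) V (\<lambda>r. act (prl V r) (prr V r)) \<and>
        (\<forall>v\<in>pts V. \<forall>e\<in>pts (vtot E). \<forall>e'\<in>pts (vtot E). vprj E e = p v \<and> vprj E e' = p v \<longrightarrow>
           p (act v e) = p v \<and> act (act v e) e' = act v (vadd E e e') \<and>
           act v (zero_section E (p v)) = v) \<and>
        (\<forall>x\<in>pts X. \<exists>U s. open_sub base_field X U \<and> x \<in> U \<and> morph base_field (subvar X U) V s \<and>
           (\<forall>y\<in>U. p (s y) = y) \<and>
           iso_morph base_field (subvar (vtot E) {e \<in> pts (vtot E). vprj E e \<in> U})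
             (subvar V {v \<in> pts V. p v \<in> U}) (\<lambda>e. act (s (vprj E e)) e)))"


section \<open>Oriented cohomology theories\<close>

text \<open>\<open>pull X Y f: h(Y) \<rightarrow> h(X)\<close> for a morphism \<open>f: X \<rightarrow> Y\<close> and \<open>push X Y f: h(X) \<rightarrow> h(Y)\<close> for a
  projective one. Rings are not graded, and
  maps are functions on all points, of which only the values on the source matter.\<close>

record (overloaded) ('k, 'x) oct =
  hr :: "'k variety \<Rightarrow> 'x ring"
  pull :: "'k variety \<Rightarrow> 'k variety \<Rightarrow> ('k pt \<Rightarrow> 'k pt) \<Rightarrow> 'x \<Rightarrow> 'x"
  push :: "'k variety \<Rightarrow> 'k variety \<Rightarrow> ('k pt \<Rightarrow> 'k pt) \<Rightarrow> 'x \<Rightarrow> 'x"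

definition chern1 :: "('k::field, 'x) oct \<Rightarrow> 'k variety \<Rightarrow> 'k vbundle \<Rightarrow> 'x" where
  "chern1 h X L = pull h X (vtot L) (zero_section L)
     (push h X (vtot L) (zero_section L) \<one>\<^bsub>hr h X\<^esub>)"

definition oct_pullbacks :: "('k::field, 'x) oct \<Rightarrow> bool" where
  "oct_pullbacks h \<longleftrightarrow>
     (\<forall>X\<in>Sm. cring (hr h X)) \<and>
     (\<forall>X\<in>Sm. \<forall>Y\<in>Sm. \<forall>f. morph base_field X Y f \<longrightarrow> pull h X Y f \<in> ring_hom (hr h Y) (hr h X)) \<and>
     (\<forall>X\<in>Sm. \<forall>Y\<in>Sm. \<forall>f g. morph base_field X Y f \<and> (\<forall>x\<in>pts X. f x = g x) \<longrightarrow>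
        (\<forall>a\<in>carrier (hr h Y). pull h X Y f a = pull h X Y g a)) \<and>
     (\<forall>X\<in>Sm. \<forall>a\<in>carrier (hr h X). pull h X X (\<lambda>x. x) a = a) \<and>
     (\<forall>X\<in>Sm. \<forall>Y\<in>Sm. \<forall>Z\<in>Sm. \<forall>f g. morph base_field X Y f \<and> morph base_field Y Z g \<longrightarrow>
        (\<forall>a\<in>carrier (hr h Z). pull h X Z (g \<circ> f) a = pull h X Y f (pull h Y Z g a))) \<and>
     (\<forall>X\<in>Sm. \<forall>U V. open_sub base_field X U \<and> open_sub base_field X V \<and> U \<inter> V = {} \<and> U \<union> V = pts X \<longrightarrow>
        bij_betw (\<lambda>a. (pull h (subvar X U) X (\<lambda>x. x) a, pull h (subvar X V) X (\<lambda>x. x) a))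
          (carrier (hr h X)) (carrier (hr h (subvar X U)) \<times> carrier (hr h (subvar X V))))"

definition oct_pushforwards :: "('k::field, 'x) oct \<Rightarrow> bool" where
  "oct_pushforwards h \<longleftrightarrow>
     (\<forall>X\<in>Sm. \<forall>Y\<in>Sm. \<forall>f. projective_morph X Y f \<longrightarrow>
        push h X Y f \<in> hom (add_monoid (hr h X)) (add_monoid (hr h Y)) \<and>
        (\<forall>a\<in>carrier (hr h X). \<forall>b\<in>carrier (hr h Y).
           push h X Y f (pull h X Y f b \<otimes>\<^bsub>hr h X\<^esub> a) = b \<otimes>\<^bsub>hr h Y\<^esub> push h X Y f a) \<and>
        (\<forall>g. (\<forall>x\<in>pts X. f x = g x) \<longrightarrow>
           (\<forall>a\<in>carrier (hr h X). push h X Y f a = push h X Y g a))) \<and>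
     (\<forall>X\<in>Sm. \<forall>a\<in>carrier (hr h X). push h X X (\<lambda>x. x) a = a) \<and>
     (\<forall>X\<in>Sm. \<forall>Y\<in>Sm. \<forall>Z\<in>Sm. \<forall>f g. projective_morph X Y f \<and> projective_morph Y Z g \<longrightarrow>
        (\<forall>a\<in>carrier (hr h X). push h X Z (g \<circ> f) a = push h Y Z g (push h X Y f a))) \<and>
     (\<forall>X\<in>Sm. \<forall>Y\<in>Sm. \<forall>Z\<in>Sm. \<forall>f g. transverse X Y Z f g \<and> projective_morph Y Z g \<longrightarrow>
        (\<forall>a\<in>carrier (hr h Y). pull h X Z f (push h Y Z g a) =
           push h (fibre_prod X Y f g) X (prl X) (pull h (fibre_prod X Y f g) Y (prr X) a)))"

definition projective_bundle_formula :: "('k::field, 'x) oct \<Rightarrow> bool" where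
  "projective_bundle_formula h \<longleftrightarrow>
     (\<forall>X E n P q L. projective_bundle X E n P q L \<longrightarrow>
        (\<forall>a\<in>carrier (hr h P). \<exists>!b. b \<in> {..n} \<rightarrow>\<^sub>E carrier (hr h X) \<and>
           a = (\<Oplus>\<^bsub>hr h P\<^esub>i\<in>{..n}. pull h P X q (b i) \<otimes>\<^bsub>hr h P\<^esub> (chern1 h P L [^]\<^bsub>hr h P\<^esub> i))))"

definition extended_homotopy :: "('k::field, 'x) oct \<Rightarrow> bool" where
  "extended_homotopy h \<longleftrightarrow>
     (\<forall>X E V p. affine_bundle X E V p \<longrightarrow> bij_betw (pull h V X p) (carrier (hr h X)) (carrier (hr h V)))"

definition oriented_theory :: "('k::field, 'x) oct \<Rightarrow> bool" where
  "oriented_theory h \<longleftrightarrow> oct_pullbacks h \<and> oct_pushforwards h \<and>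
     projective_bundle_formula h \<and> extended_homotopy h"

text \<open>\<open>F i j\<close> is the coefficient of \<open>x^i y^j\<close>. First Chern classes are nilpotent, so the value of the
  power series at them is an eventually constant sequence of partial sums.\<close>

definition formal_group_law :: "('k::field, 'x) oct \<Rightarrow> (nat \<Rightarrow> nat \<Rightarrow> 'x) \<Rightarrow> bool" where
  "formal_group_law h F \<longleftrightarrow> (\<forall>i j. F i j \<in> carrier (hr h Pt)) \<and>
     (\<forall>X L M N. tensor_line_bundle X L M N \<longrightarrow> (\<exists>n0. \<forall>n\<ge>n0. chern1 h X N =
        (\<Oplus>\<^bsub>hr h X\<^esub>i\<in>{..<n}. \<Oplus>\<^bsub>hr h X\<^esub>j\<in>{..<n}. pull h X Pt (\<lambda>_. []) (F i j) \<otimes>\<^bsub>hr h X\<^esub>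
           ((chern1 h X L [^]\<^bsub>hr h X\<^esub> i) \<otimes>\<^bsub>hr h X\<^esub> (chern1 h X M [^]\<^bsub>hr h X\<^esub> j)))))"

definition oct_hom :: "('k::field, 'x) oct \<Rightarrow> ('k, 'x) oct \<Rightarrow> ('k variety \<Rightarrow> 'x \<Rightarrow> 'x) \<Rightarrow> bool" where
  "oct_hom h A \<theta> \<longleftrightarrow>
     (\<forall>X\<in>Sm. \<theta> X \<in> ring_hom (hr h X) (hr A X)) \<and>
     (\<forall>X\<in>Sm. \<forall>Y\<in>Sm. \<forall>f. morph base_field X Y f \<longrightarrow>
        (\<forall>a\<in>carrier (hr h Y). \<theta> X (pull h X Y f a) = pull A X Y f (\<theta> Y a))) \<and>
     (\<forall>X\<in>Sm. \<forall>Y\<in>Sm. \<forall>f. projective_morph X Y f \<longrightarrow>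
        (\<forall>a\<in>carrier (hr h X). \<theta> Y (push h X Y f a) = push A X Y f (\<theta> X a)))"

text \<open>
  The universal property of \<open>\<Omega>(-) \<otimes>_L R\<close>, \<open>R = h(pt)\<close>, where \<open>L \<rightarrow> R\<close> classifies the formal
  group law \<open>F\<close>: since \<open>\<Omega>\<close> is the universal oriented theory with \<open>\<Omega>(pt) = L\<close>, morphisms
  \<open>\<Omega> \<otimes>_L R \<rightarrow> A\<close> are the ring homomorphisms \<open>R \<rightarrow> A(pt)\<close> taking \<open>F\<close> to the formal group law of \<open>A\<close>.
  The theories \<open>A\<close> have elements in the same type \<open>'x\<close> as \<open>h\<close>. For large \<open>'x\<close> this is no restriction,
  and for small \<open>'x\<close> it only makes the predicate weaker.
\<close>

definition free_theory :: "('k::field, 'x) oct \<Rightarrow> (nat \<Rightarrow> nat \<Rightarrow> 'x) \<Rightarrow> bool" where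
  "free_theory h F \<longleftrightarrow> (\<forall>(A :: ('k, 'x) oct) F' \<phi>.
     oriented_theory A \<and> formal_group_law A F' \<and> \<phi> \<in> ring_hom (hr h Pt) (hr A Pt) \<and>
     (\<forall>i j. \<phi> (F i j) = F' i j) \<longrightarrow>
     (\<exists>\<theta>. oct_hom h A \<theta> \<and> (\<forall>r\<in>carrier (hr h Pt). \<theta> Pt r = \<phi> r) \<and>
        (\<forall>\<theta>'. oct_hom h A \<theta>' \<and> (\<forall>r\<in>carrier (hr h Pt). \<theta>' Pt r = \<phi> r) \<longrightarrow>
           (\<forall>X\<in>Sm. \<forall>a\<in>carrier (hr h X). \<theta>' X a = \<theta> X a))))"


section \<open>Split semisimple groups\<close>

record (overloaded) 'k alg_group =
  gvar :: "'k variety"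
  gmon :: "'k pt monoid"
  torus :: "'k pt set"
  borel :: "'k pt set"

definition linear_algebraic_group :: "'k::field variety \<Rightarrow> 'k pt monoid \<Rightarrow> bool" where
  "linear_algebraic_group X M \<longleftrightarrow> is_variety X \<and> group M \<and> carrier M = pts X \<and>
     morph base_field (vprod X X) X (\<lambda>p. prl X p \<otimes>\<^bsub>M\<^esub> prr X p) \<and>
     morph base_field X X (\<lambda>x. inv\<^bsub>M\<^esub> x) \<and> morph base_field Pt X (\<lambda>_. \<one>\<^bsub>M\<^esub>) \<and>
     (\<exists>n C f. closed_sub base_field (affine_space n) C \<and>
        iso_morph base_field X (subvar (affine_space n) C) f)"

definition closed_subgroup :: "'k::field alg_closure set \<Rightarrow> 'k alg_group \<Rightarrow> 'k pt set \<Rightarrow> bool" where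
  "closed_subgroup F G H \<longleftrightarrow> subgroup H (gmon G) \<and> closed_sub F (gvar G) H"

definition zconnected :: "'k::field alg_group \<Rightarrow> 'k pt set \<Rightarrow> bool" where
  "zconnected G H \<longleftrightarrow> \<not> (\<exists>C D. closed_sub UNIV (gvar G) C \<and> closed_sub UNIV (gvar G) D \<and>
     C \<noteq> {} \<and> D \<noteq> {} \<and> C \<inter> D = {} \<and> C \<union> D = H)"

definition is_torus :: "'k::field alg_closure set \<Rightarrow> 'k alg_group \<Rightarrow> 'k pt set \<Rightarrow> bool" where
  "is_torus F G H \<longleftrightarrow> closed_subgroup F G H \<and>
     (\<exists>r f. iso_morph F (split_torus r) (subvar (gvar G) H) f \<and>
        (\<forall>s\<in>pts (split_torus r). \<forall>t\<in>pts (split_torus r).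
           f (map2 (map2 (*)) s t) = f s \<otimes>\<^bsub>gmon G\<^esub> f t))"

definition connected_solvable :: "'k::field alg_group \<Rightarrow> 'k pt set \<Rightarrow> bool" where
  "connected_solvable G H \<longleftrightarrow>
     closed_subgroup UNIV G H \<and> zconnected G H \<and> solvable ((gmon G)\<lparr>carrier := H\<rparr>)"

definition split_semisimple :: "'k::field alg_group \<Rightarrow> bool" where
  "split_semisimple G \<longleftrightarrow>
     linear_algebraic_group (gvar G) (gmon G) \<and> zconnected G (carrier (gmon G)) \<and>
     (\<forall>H. connected_solvable G H \<and> H \<lhd> gmon G \<longrightarrow> H = {\<one>\<^bsub>gmon G\<^esub>}) \<and>
     is_torus base_field G (torus G) \<and>
     (\<forall>H. is_torus UNIV G H \<and> torus G \<subseteq> H \<longrightarrow> H = torus G) \<and>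
     closed_subgroup base_field G (borel G) \<and> connected_solvable G (borel G) \<and>
     (\<forall>H. connected_solvable G H \<and> borel G \<subseteq> H \<longrightarrow> H = borel G) \<and>
     torus G \<subseteq> borel G"

definition parabolics :: "'k::field alg_group \<Rightarrow> 'k pt set set" where
  "parabolics G = {P. closed_subgroup base_field G P \<and> borel G \<subseteq> P}"

text \<open>The character group is written multiplicatively: \<open>\<lambda> + \<mu>\<close> is \<open>\<lambda> \<otimes> \<mu>\<close> below.\<close>

type_synonym 'k character = "'k pt \<Rightarrow> 'k alg_closure"

definition chars :: "'k::field alg_group \<Rightarrow> 'k character monoid" where
  "chars G = \<lparr>
     carrier = {\<chi> \<in> extensional (torus G).
       morph base_field (subvar (gvar G) (torus G)) (split_torus 1) (\<lambda>t. [[1, \<chi> t]]) \<and>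
       (\<forall>s\<in>torus G. \<forall>t\<in>torus G. \<chi> (s \<otimes>\<^bsub>gmon G\<^esub> t) = \<chi> s * \<chi> t)},
     monoid.mult = (\<lambda>\<chi> \<psi>. \<lambda>t\<in>torus G. \<chi> t * \<psi> t),
     one = (\<lambda>t\<in>torus G. 1)\<rparr>"

text \<open>\<open>D\<close> is an element of the Lie algebra of \<open>H\<close>: a point derivation at 1 of the ring of regular
  functions on the affine variety \<open>H\<close>.\<close>

definition lie_vector :: "'k::field alg_group \<Rightarrow> 'k pt set \<Rightarrow> (('k pt \<Rightarrow> 'k alg_closure) \<Rightarrow> 'k alg_closure) \<Rightarrow> bool" where
  "lie_vector G H D \<longleftrightarrow>
     (\<forall>\<phi> \<psi>. regular UNIV (subvar (gvar G) H) \<phi> \<and> regular UNIV (subvar (gvar G) H) \<psi> \<longrightarrow>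
        ((\<forall>x\<in>H. \<phi> x = \<psi> x) \<longrightarrow> D \<phi> = D \<psi>) \<and>
        D (\<lambda>x. \<phi> x + \<psi> x) = D \<phi> + D \<psi> \<and>
        (\<forall>c. D (\<lambda>x. c * \<phi> x) = c * D \<phi>) \<and>
        D (\<lambda>x. \<phi> x * \<psi> x) = \<phi> \<one>\<^bsub>gmon G\<^esub> * D \<psi> + D \<phi> * \<psi> \<one>\<^bsub>gmon G\<^esub>)"

text \<open>The nontrivial weights of \<open>T\<close> on the Lie algebra of a closed subgroup \<open>H\<close> containing \<open>T\<close>.\<close>

definition roots_of :: "'k::field alg_group \<Rightarrow> 'k pt set \<Rightarrow> 'k character set" where
  "roots_of G H = {\<alpha> \<in> carrier (chars G). \<alpha> \<noteq> \<one>\<^bsub>chars G\<^esub> \<and>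
     (\<exists>D. lie_vector G H D \<and> (\<exists>\<phi>. regular UNIV (subvar (gvar G) H) \<phi> \<and> D \<phi> \<noteq> 0) \<and>
        (\<forall>t\<in>torus G. \<forall>\<phi>. regular UNIV (subvar (gvar G) H) \<phi> \<longrightarrow>
           D (\<lambda>x. \<phi> (t \<otimes>\<^bsub>gmon G\<^esub> x \<otimes>\<^bsub>gmon G\<^esub> inv\<^bsub>gmon G\<^esub> t)) = \<alpha> t * D \<phi>))}"

definition roots :: "'k::field alg_group \<Rightarrow> 'k character set" where
  "roots G = roots_of G (carrier (gmon G))"

definition pos_roots :: "'k::field alg_group \<Rightarrow> 'k character set" where
  "pos_roots G = roots_of G (borel G)"

definition simple_roots :: "'k::field alg_group \<Rightarrow> 'k character set" where
  "simple_roots G = {\<alpha> \<in> pos_roots G.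
     \<not> (\<exists>\<beta>\<in>pos_roots G. \<exists>\<gamma>\<in>pos_roots G. \<alpha> = \<beta> \<otimes>\<^bsub>chars G\<^esub> \<gamma>)}"

definition simple_roots_of :: "'k::field alg_group \<Rightarrow> 'k pt set \<Rightarrow> 'k character set" where
  "simple_roots_of G P = {\<alpha> \<in> simple_roots G. inv\<^bsub>chars G\<^esub> \<alpha> \<in> roots_of G P}"

definition pos_roots_of :: "'k::field alg_group \<Rightarrow> 'k pt set \<Rightarrow> 'k character set" where
  "pos_roots_of G P = pos_roots G \<inter> generate (chars G) (simple_roots_of G P)"

text \<open>Elements of the Weyl group are cosets \<open>nT\<close>, \<open>n\<close> in the normalizer of \<open>T\<close>.\<close>

definition weyl :: "'k::field alg_group \<Rightarrow> 'k pt set monoid" where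
  "weyl G = ((gmon G)\<lparr>carrier := normalizer (gmon G) (torus G)\<rparr>) Mod torus G"

text \<open>\<open>w(\<chi>)(t) = \<chi>(n^(-1) t n)\<close> for \<open>w = nT\<close>\<close>

definition weyl_act :: "'k::field alg_group \<Rightarrow> 'k pt set \<Rightarrow> 'k character \<Rightarrow> 'k character" where
  "weyl_act G w \<chi> = (let n = (SOME n. n \<in> w) in
     (\<lambda>t\<in>torus G. \<chi> (inv\<^bsub>gmon G\<^esub> n \<otimes>\<^bsub>gmon G\<^esub> t \<otimes>\<^bsub>gmon G\<^esub> n)))"

definition reflection :: "'k::field alg_group \<Rightarrow> 'k character \<Rightarrow> 'k pt set" where
  "reflection G \<alpha> = (THE w. w \<in> carrier (weyl G) \<and> w \<noteq> \<one>\<^bsub>weyl G\<^esub> \<and>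
     (\<forall>\<chi>\<in>carrier (chars G). \<exists>n::int. weyl_act G w \<chi> = \<chi> \<otimes>\<^bsub>chars G\<^esub> (\<alpha> [^]\<^bsub>chars G\<^esub> n)))"

text \<open>Every connected component of the Dynkin diagram is of type \<open>A_n\<close>, i.e. the diagram is a
  disjoint union of simply laced paths.\<close>

definition type_A :: "'k::field alg_group \<Rightarrow> bool" where
  "type_A G \<longleftrightarrow> (\<exists>as. distinct as \<and> set as = simple_roots G \<and>
     (\<forall>i<length as. \<forall>j<length as. i \<noteq> j \<longrightarrow>
        weyl_act G (reflection G (as ! j)) (as ! i) = as ! i \<or>
        ((i = Suc j \<or> j = Suc i) \<and>
         weyl_act G (reflection G (as ! j)) (as ! i) = as ! i \<otimes>\<^bsub>chars G\<^esub> as ! j)))"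


section \<open>Double moment graphs\<close>

definition weyl_length :: "'k::field alg_group \<Rightarrow> 'k pt set \<Rightarrow> nat" where
  "weyl_length G w = (LEAST n. \<exists>ws. length ws = n \<and> set ws \<subseteq> reflection G ` simple_roots G \<and>
     w = foldr (monoid.mult (weyl G)) ws \<one>\<^bsub>weyl G\<^esub>)"

definition bruhat :: "'k::field alg_group \<Rightarrow> 'k pt set \<Rightarrow> 'k pt set \<Rightarrow> bool" where
  "bruhat G u v \<longleftrightarrow> (u, v) \<in> {(a, b). a \<in> carrier (weyl G) \<and> weyl_length G a < weyl_length G b \<and>
     (\<exists>\<beta>\<in>pos_roots G. b = reflection G \<beta> \<otimes>\<^bsub>weyl G\<^esub> a)}\<^sup>*"

definition parabolic_weyl :: "'k::field alg_group \<Rightarrow> 'k pt set \<Rightarrow> 'k pt set set" where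
  "parabolic_weyl G P = generate (weyl G) (reflection G ` simple_roots_of G P)"

definition double_coset :: "'k::field alg_group \<Rightarrow> 'k pt set \<Rightarrow> 'k pt set \<Rightarrow> 'k pt set \<Rightarrow> 'k pt set set" where
  "double_coset G Q P w = {a \<otimes>\<^bsub>weyl G\<^esub> w \<otimes>\<^bsub>weyl G\<^esub> b | a b.
     a \<in> parabolic_weyl G Q \<and> b \<in> parabolic_weyl G P}"

definition min_reps :: "'k::field alg_group \<Rightarrow> 'k pt set \<Rightarrow> 'k pt set \<Rightarrow> 'k pt set set" where
  "min_reps G Q P = {w \<in> carrier (weyl G). \<forall>v\<in>double_coset G Q P w. weyl_length G w \<le> weyl_length G v}"

definition min_rep :: "'k::field alg_group \<Rightarrow> 'k pt set \<Rightarrow> 'k pt set \<Rightarrow> 'k pt set \<Rightarrow> 'k pt set" where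
  "min_rep G Q P w = (THE u. u \<in> min_reps G Q P \<and> u \<in> double_coset G Q P w)"

definition edge_roots ::
  "'k::field alg_group \<Rightarrow> 'k pt set \<Rightarrow> 'k pt set \<Rightarrow> 'k pt set \<Rightarrow> 'k pt set \<Rightarrow> 'k character set" where
  "edge_roots G Q P u u' = {\<beta> \<in> pos_roots G.
     bruhat G u (reflection G \<beta> \<otimes>\<^bsub>weyl G\<^esub> u) \<and> u' = min_rep G Q P (reflection G \<beta> \<otimes>\<^bsub>weyl G\<^esub> u)}"

definition edges :: "'k::field alg_group \<Rightarrow> 'k pt set \<Rightarrow> 'k pt set \<Rightarrow> ('k pt set \<times> 'k pt set) set" where
  "edges G Q P = {(u, u'). u \<in> min_reps G Q P \<and> u' \<in> min_reps G Q P \<and> u \<noteq> u' \<and> edge_roots G Q P u u' \<noteq> {}}"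

type_synonym 'k labelling = "'k pt set \<Rightarrow> 'k pt set \<Rightarrow> 'k pt set \<Rightarrow> 'k pt set \<Rightarrow> 'k character"

definition is_labelling :: "'k::field alg_group \<Rightarrow> 'k labelling \<Rightarrow> bool" where
  "is_labelling G l \<longleftrightarrow> (\<forall>Q\<in>parabolics G. \<forall>P\<in>parabolics G. \<forall>(u, u')\<in>edges G Q P.
     l Q P u u' \<in> edge_roots G Q P u u')"

definition stab_weyl :: "'k::field alg_group \<Rightarrow> 'k pt set \<Rightarrow> 'k pt set \<Rightarrow> 'k pt set \<Rightarrow> 'k pt set set" where
  "stab_weyl G Q P u = generate (weyl G)
     (reflection G ` (simple_roots_of G Q \<inter> weyl_act G u ` pos_roots_of G P))"

definition stab_min_reps :: "'k::field alg_group \<Rightarrow> 'k pt set \<Rightarrow> 'k pt set \<Rightarrow> 'k pt set \<Rightarrow> 'k pt set set" where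
  "stab_min_reps G Q P u = {w \<in> parabolic_weyl G Q.
     \<forall>v\<in>stab_weyl G Q P u. weyl_length G w \<le> weyl_length G (w \<otimes>\<^bsub>weyl G\<^esub> v)}"


section \<open>The formal group ring\<close>

text \<open>
  \<open>R[[x_c]]\<close> for \<open>c\<close> in a possibly infinite set \<open>C\<close>: formal sums with finitely many terms in
  each degree, i.e. the completion of the polynomial ring at the augmentation ideal.
  With \<open>fin = True\<close>, the polynomial ring.
\<close>

type_synonym ('c, 'x) series = "('c \<Rightarrow>\<^sub>0 nat) \<Rightarrow> 'x"

definition mono_degree :: "('c \<Rightarrow>\<^sub>0 nat) \<Rightarrow> nat" where
  "mono_degree m = (\<Sum>c\<in>Poly_Mapping.keys m. Poly_Mapping.lookup m c)"

definition series_ring :: "bool \<Rightarrow> 'x ring \<Rightarrow> 'c set \<Rightarrow> ('c, 'x) series ring" where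
  "series_ring fin R C = \<lparr>
     carrier = {f. (\<forall>m. f m \<in> carrier R) \<and> (\<forall>m. \<not> Poly_Mapping.keys m \<subseteq> C \<longrightarrow> f m = \<zero>\<^bsub>R\<^esub>) \<and>
       (\<forall>n. finite {m. f m \<noteq> \<zero>\<^bsub>R\<^esub> \<and> mono_degree m = n}) \<and> (fin \<longrightarrow> finite {m. f m \<noteq> \<zero>\<^bsub>R\<^esub>})},
     monoid.mult = (\<lambda>f g m. \<Oplus>\<^bsub>R\<^esub>p\<in>{(a, b). a + b = m}. f (fst p) \<otimes>\<^bsub>R\<^esub> g (snd p)),
     one = (\<lambda>m. if m = 0 then \<one>\<^bsub>R\<^esub> else \<zero>\<^bsub>R\<^esub>),
     ring.zero = (\<lambda>m. \<zero>\<^bsub>R\<^esub>),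
     add = (\<lambda>f g m. f m \<oplus>\<^bsub>R\<^esub> g m)\<rparr>"

definition series_var :: "'x ring \<Rightarrow> 'c \<Rightarrow> ('c, 'x) series" where
  "series_var R c = (\<lambda>m. if m = Poly_Mapping.single c 1 then \<one>\<^bsub>R\<^esub> else \<zero>\<^bsub>R\<^esub>)"

definition series_fgl :: "'x ring \<Rightarrow> (nat \<Rightarrow> nat \<Rightarrow> 'x) \<Rightarrow> 'c \<Rightarrow> 'c \<Rightarrow> ('c, 'x) series" where
  "series_fgl R F c d = (\<lambda>m. \<Oplus>\<^bsub>R\<^esub>p\<in>{(i, j). Poly_Mapping.single c i + Poly_Mapping.single d j = m}. F (fst p) (snd p))"

definition fgl_relations ::
  "bool \<Rightarrow> 'x ring \<Rightarrow> (nat \<Rightarrow> nat \<Rightarrow> 'x) \<Rightarrow> 'c monoid \<Rightarrow> ('c, 'x) series set" where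
  "fgl_relations fin R F M = insert (series_var R \<one>\<^bsub>M\<^esub>)
     {series_var R (c \<otimes>\<^bsub>M\<^esub> d) \<ominus>\<^bsub>series_ring fin R (carrier M)\<^esub> series_fgl R F c d | c d.
        c \<in> carrier M \<and> d \<in> carrier M}"

definition fgl_ideal ::
  "bool \<Rightarrow> 'x ring \<Rightarrow> (nat \<Rightarrow> nat \<Rightarrow> 'x) \<Rightarrow> 'c monoid \<Rightarrow> ('c, 'x) series set" where
  "fgl_ideal fin R F M = {f \<in> carrier (series_ring fin R (carrier M)).
     \<forall>n. \<exists>g\<in>genideal (series_ring fin R (carrier M)) (fgl_relations fin R F M).
       \<forall>m. mono_degree m < n \<longrightarrow> f m = g m}"

definition formal_group_ring ::
  "bool \<Rightarrow> 'x ring \<Rightarrow> (nat \<Rightarrow> nat \<Rightarrow> 'x) \<Rightarrow> 'c monoid \<Rightarrow> ('c, 'x) series set ring" where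
  "formal_group_ring fin R F M = series_ring fin R (carrier M) Quot fgl_ideal fin R F M"

definition fgr_class ::
  "bool \<Rightarrow> 'x ring \<Rightarrow> (nat \<Rightarrow> nat \<Rightarrow> 'x) \<Rightarrow> 'c monoid \<Rightarrow> ('c, 'x) series \<Rightarrow> ('c, 'x) series set" where
  "fgr_class fin R F M f = fgl_ideal fin R F M +>\<^bsub>series_ring fin R (carrier M)\<^esub> f"


section \<open>Equivariant cohomology\<close>

record (overloaded) 'k gvariety =
  gsp :: "'k variety"
  gact :: "'k pt \<Rightarrow> 'k pt \<Rightarrow> 'k pt"

definition gpoint :: "'k::field gvariety" where
  "gpoint = \<lparr>gsp = Pt, gact = (\<lambda>g x. x)\<rparr>"

definition gprod :: "'k::field gvariety \<Rightarrow> 'k gvariety \<Rightarrow> 'k gvariety" where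
  "gprod X Y = \<lparr>gsp = vprod (gsp X) (gsp Y),
     gact = (\<lambda>g p. gact X g (prl (gsp X) p) @ gact Y g (prr (gsp X) p))\<rparr>"

definition gline :: "'k::field character \<Rightarrow> 'k gvariety" where
  "gline \<chi> = \<lparr>gsp = affine_space 1, gact = (\<lambda>t p. avec [\<chi> t * p ! 0 ! 1])\<rparr>"

text \<open>The quotient \<open>G \<rightarrow> G/P\<close>, characterized by its fibres and the quotient topology and sheaf of
  functions.\<close>

definition is_coset_space ::
  "'k::field alg_group \<Rightarrow> 'k pt set \<Rightarrow> 'k variety \<Rightarrow> ('k pt \<Rightarrow> 'k pt) \<Rightarrow> bool" where
  "is_coset_space G P Y \<pi> \<longleftrightarrow> Y \<in> Sm \<and> morph base_field (gvar G) Y \<pi> \<and> \<pi> ` pts (gvar G) = pts Y \<and>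
     (\<forall>g\<in>pts (gvar G). \<forall>h\<in>pts (gvar G). \<pi> g = \<pi> h \<longleftrightarrow> inv\<^bsub>gmon G\<^esub> g \<otimes>\<^bsub>gmon G\<^esub> h \<in> P) \<and>
     (\<forall>U. open_sub UNIV (gvar G) U \<longrightarrow> open_sub UNIV Y (\<pi> ` U)) \<and>
     (\<forall>U \<phi>. open_sub UNIV Y U \<and>
        regular UNIV (subvar (gvar G) {g \<in> pts (gvar G). \<pi> g \<in> U}) (\<phi> \<circ> \<pi>) \<longrightarrow>
        regular UNIV (subvar Y U) \<phi>)"

definition coset_space :: "'k::field alg_group \<Rightarrow> 'k pt set \<Rightarrow> 'k variety \<times> ('k pt \<Rightarrow> 'k pt)" where
  "coset_space G P = (SOME (Y, \<pi>). is_coset_space G P Y \<pi>)"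

definition flag :: "'k::field alg_group \<Rightarrow> 'k pt set \<Rightarrow> 'k gvariety" where
  "flag G P = (case coset_space G P of (Y, \<pi>) \<Rightarrow> \<lparr>gsp = Y,
     gact = (\<lambda>g y. \<pi> (g \<otimes>\<^bsub>gmon G\<^esub> (SOME h. h \<in> pts (gvar G) \<and> \<pi> h = y)))\<rparr>)"

text \<open>
  A system of representations \<open>V_i\<close> of \<open>G\<close> (acting from the right) with invariant open subsets
  \<open>U_i\<close>, as used in the Borel construction. Points of \<open>V_i\<close> are lists of length \<open>rdim i\<close>.
\<close>

record (overloaded) 'k rep_system =
  rdim :: "nat \<Rightarrow> nat"
  ropen :: "nat \<Rightarrow> 'k pt set"
  ract :: "nat \<Rightarrow> 'k alg_closure list \<Rightarrow> 'k pt \<Rightarrow> 'k alg_closure list"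

definition uvar :: "'k::field rep_system \<Rightarrow> nat \<Rightarrow> 'k variety" where
  "uvar \<U> i = subvar (affine_space (rdim \<U> i)) (ropen \<U> i)"

definition uact :: "'k::field rep_system \<Rightarrow> nat \<Rightarrow> 'k pt \<Rightarrow> 'k pt \<Rightarrow> 'k pt" where
  "uact \<U> i v g = avec (ract \<U> i (tl (hd v)) g)"

text \<open>Zariski locally trivial principal bundles; for a split torus, Zariski and etale local
  triviality agree.\<close>

definition is_torsor ::
  "'k::field alg_group \<Rightarrow> 'k variety \<Rightarrow> ('k pt \<Rightarrow> 'k pt \<Rightarrow> 'k pt) \<Rightarrow> 'k variety \<Rightarrow> ('k pt \<Rightarrow> 'k pt) \<Rightarrow> bool" where
  "is_torsor G E act Z \<pi> \<longleftrightarrow> Z \<in> Sm \<and> morph base_field E Z \<pi> \<and>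
     (\<forall>z\<in>pts Z. \<exists>U \<phi>. open_sub base_field Z U \<and> z \<in> U \<and>
        iso_morph base_field (vprod (subvar Z U) (subvar (gvar G) (torus G)))
          (subvar E {e \<in> pts E. \<pi> e \<in> U}) \<phi> \<and>
        (\<forall>y\<in>U. \<forall>t\<in>torus G. \<pi> (\<phi> (y @ t)) = y \<and>
           (\<forall>s\<in>torus G. \<phi> (y @ (t \<otimes>\<^bsub>gmon G\<^esub> s)) = act (\<phi> (y @ t)) s)))"

text \<open>Codimension at least \<open>c\<close> in affine \<open>n\<close>-space, via the Krull dimension of \<open>C\<close>.\<close>

definition codim_ge :: "nat \<Rightarrow> 'k::field pt set \<Rightarrow> nat \<Rightarrow> bool" where
  "codim_ge n C c \<longleftrightarrow> (\<forall>m D.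
     (\<forall>j\<le>m. closed_sub UNIV (affine_space n) (D j) \<and> D j \<subseteq> C \<and> D j \<noteq> {} \<and>
        \<not> (\<exists>A B. closed_sub UNIV (affine_space n) A \<and> closed_sub UNIV (affine_space n) B \<and>
             A \<noteq> D j \<and> B \<noteq> D j \<and> A \<union> B = D j)) \<and>
     (\<forall>j<m. D j \<subset> D (Suc j)) \<longrightarrow> m + c \<le> n)"

definition good_system :: "'k::field alg_group \<Rightarrow> 'k rep_system \<Rightarrow> bool" where
  "good_system G \<U> \<longleftrightarrow>
     (\<forall>i. morph base_field (vprod (affine_space (rdim \<U> i)) (gvar G)) (affine_space (rdim \<U> i))
            (\<lambda>p. uact \<U> i (prl (affine_space (rdim \<U> i)) p) (prr (affine_space (rdim \<U> i)) p))) \<and>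
     (\<forall>i a b. length a = rdim \<U> i \<and> length b = rdim \<U> i \<longrightarrow>
        ract \<U> i a \<one>\<^bsub>gmon G\<^esub> = a \<and>
        (\<forall>g\<in>pts (gvar G).
           (\<forall>g'\<in>pts (gvar G). ract \<U> i (ract \<U> i a g) g' = ract \<U> i a (g \<otimes>\<^bsub>gmon G\<^esub> g')) \<and>
           ract \<U> i (map2 (+) a b) g = map2 (+) (ract \<U> i a g) (ract \<U> i b g) \<and>
           (\<forall>c. ract \<U> i (map ((*) c) a) g = map ((*) c) (ract \<U> i a g)))) \<and>
     (\<forall>i. open_sub base_field (affine_space (rdim \<U> i)) (ropen \<U> i) \<and>
        (\<forall>v\<in>ropen \<U> i. \<forall>g\<in>pts (gvar G). uact \<U> i v g \<in> ropen \<U> i)) \<and>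
     (\<forall>i. rdim \<U> i \<le> rdim \<U> (Suc i) \<and>
        (\<exists>\<rho>. \<forall>a b. length a = rdim \<U> i \<and> length b = rdim \<U> (Suc i) - rdim \<U> i \<longrightarrow>
           (\<forall>g\<in>pts (gvar G). ract \<U> (Suc i) (a @ b) g = ract \<U> i a g @ \<rho> b g) \<and>
           (avec a \<in> ropen \<U> i \<longrightarrow> avec (a @ b) \<in> ropen \<U> (Suc i)))) \<and>
     (\<forall>c. \<exists>i0. \<forall>i\<ge>i0. codim_ge (rdim \<U> i) (pts (affine_space (rdim \<U> i)) - ropen \<U> i) c) \<and>
     (\<forall>i. \<exists>Z \<pi>. is_torsor G (uvar \<U> i) (uact \<U> i) Z \<pi>)"

text \<open>The space \<open>U_i \<times>^T X\<close> with the projection from \<open>U_i \<times> X\<close>; \<open>T\<close> acts from the right by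
  \<open>(v, x) t = (v t, t^(-1) x)\<close>.\<close>

definition borel_act ::
  "'k::field alg_group \<Rightarrow> 'k rep_system \<Rightarrow> 'k gvariety \<Rightarrow> nat \<Rightarrow> 'k pt \<Rightarrow> 'k pt \<Rightarrow> 'k pt" where
  "borel_act G \<U> X i e g =
     uact \<U> i (prl (uvar \<U> i) e) g @ gact X (inv\<^bsub>gmon G\<^esub> g) (prr (uvar \<U> i) e)"

definition borel_quot ::
  "'k::field alg_group \<Rightarrow> 'k rep_system \<Rightarrow> 'k gvariety \<Rightarrow> nat \<Rightarrow> 'k variety \<times> ('k pt \<Rightarrow> 'k pt)" where
  "borel_quot G \<U> X i =
     (SOME (Z, \<pi>). is_torsor G (vprod (uvar \<U> i) (gsp X)) (borel_act G \<U> X i) Z \<pi>)"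

definition borel_space :: "'k::field alg_group \<Rightarrow> 'k rep_system \<Rightarrow> 'k gvariety \<Rightarrow> nat \<Rightarrow> 'k variety" where
  "borel_space G \<U> X i = fst (borel_quot G \<U> X i)"

definition borel_proj :: "'k::field alg_group \<Rightarrow> 'k rep_system \<Rightarrow> 'k gvariety \<Rightarrow> nat \<Rightarrow> 'k pt \<Rightarrow> 'k pt" where
  "borel_proj G \<U> X i = snd (borel_quot G \<U> X i)"

definition borel_lift :: "'k::field alg_group \<Rightarrow> 'k rep_system \<Rightarrow> 'k gvariety \<Rightarrow> nat \<Rightarrow> 'k pt \<Rightarrow> 'k pt" where
  "borel_lift G \<U> X i z = (SOME e. e \<in> pts (vprod (uvar \<U> i) (gsp X)) \<and> borel_proj G \<U> X i e = z)"

definition borel_map ::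
  "'k::field alg_group \<Rightarrow> 'k rep_system \<Rightarrow> 'k gvariety \<Rightarrow> 'k gvariety \<Rightarrow> ('k pt \<Rightarrow> 'k pt) \<Rightarrow> nat \<Rightarrow> 'k pt \<Rightarrow> 'k pt" where
  "borel_map G \<U> X Y f i z = (let e = borel_lift G \<U> X i z in
     borel_proj G \<U> Y i (prl (uvar \<U> i) e @ f (prr (uvar \<U> i) e)))"

definition borel_step :: "'k::field alg_group \<Rightarrow> 'k rep_system \<Rightarrow> 'k gvariety \<Rightarrow> nat \<Rightarrow> 'k pt \<Rightarrow> 'k pt" where
  "borel_step G \<U> X i z = (let e = borel_lift G \<U> X i z in
     borel_proj G \<U> X (Suc i)
       (avec (tl (hd (prl (uvar \<U> i) e)) @ replicate (rdim \<U> (Suc i) - rdim \<U> i) 0) @ prr (uvar \<U> i) e))"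

text \<open>Right action of \<open>w\<close> on \<open>U_i \<times>^T X\<close>, through a \<open>k\<close>-rational representative of \<open>w\<close>.\<close>

definition borel_weyl ::
  "'k::field alg_group \<Rightarrow> 'k rep_system \<Rightarrow> 'k gvariety \<Rightarrow> 'k pt set \<Rightarrow> nat \<Rightarrow> 'k pt \<Rightarrow> 'k pt" where
  "borel_weyl G \<U> X w i z = (let n = (SOME n. n \<in> w \<and> (\<forall>a\<in>set n. set a \<subseteq> base_field)) in
     borel_proj G \<U> X i (borel_act G \<U> X i (borel_lift G \<U> X i z) n))"

definition hT :: "'k::field alg_group \<Rightarrow> 'k rep_system \<Rightarrow> ('k, 'x) oct \<Rightarrow> 'k gvariety \<Rightarrow> (nat \<Rightarrow> 'x) ring" where
  "hT G \<U> h X = \<lparr>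
     carrier = {a. \<forall>i. a i \<in> carrier (hr h (borel_space G \<U> X i)) \<and>
       a i = pull h (borel_space G \<U> X i) (borel_space G \<U> X (Suc i)) (borel_step G \<U> X i) (a (Suc i))},
     monoid.mult = (\<lambda>a b i. a i \<otimes>\<^bsub>hr h (borel_space G \<U> X i)\<^esub> b i),
     one = (\<lambda>i. \<one>\<^bsub>hr h (borel_space G \<U> X i)\<^esub>),
     ring.zero = (\<lambda>i. \<zero>\<^bsub>hr h (borel_space G \<U> X i)\<^esub>),
     add = (\<lambda>a b i. a i \<oplus>\<^bsub>hr h (borel_space G \<U> X i)\<^esub> b i)\<rparr>"

definition pullT ::
  "'k::field alg_group \<Rightarrow> 'k rep_system \<Rightarrow> ('k, 'x) oct \<Rightarrow> 'k gvariety \<Rightarrow> 'k gvariety \<Rightarrow>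
     ('k pt \<Rightarrow> 'k pt) \<Rightarrow> (nat \<Rightarrow> 'x) \<Rightarrow> nat \<Rightarrow> 'x" where
  "pullT G \<U> h X Y f a = (\<lambda>i. pull h (borel_space G \<U> X i) (borel_space G \<U> Y i) (borel_map G \<U> X Y f i) (a i))"

definition pushT ::
  "'k::field alg_group \<Rightarrow> 'k rep_system \<Rightarrow> ('k, 'x) oct \<Rightarrow> 'k gvariety \<Rightarrow> 'k gvariety \<Rightarrow>
     ('k pt \<Rightarrow> 'k pt) \<Rightarrow> (nat \<Rightarrow> 'x) \<Rightarrow> nat \<Rightarrow> 'x" where
  "pushT G \<U> h X Y f a = (\<lambda>i. push h (borel_space G \<U> X i) (borel_space G \<U> Y i) (borel_map G \<U> X Y f i) (a i))"

definition weylT ::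
  "'k::field alg_group \<Rightarrow> 'k rep_system \<Rightarrow> ('k, 'x) oct \<Rightarrow> 'k gvariety \<Rightarrow> 'k pt set \<Rightarrow>
     (nat \<Rightarrow> 'x) \<Rightarrow> nat \<Rightarrow> 'x" where
  "weylT G \<U> h X w a = (\<lambda>i. pull h (borel_space G \<U> X i) (borel_space G \<U> X i) (borel_weyl G \<U> X w i) (a i))"

definition hTW :: "'k::field alg_group \<Rightarrow> 'k rep_system \<Rightarrow> ('k, 'x) oct \<Rightarrow> 'k gvariety \<Rightarrow> (nat \<Rightarrow> 'x) ring" where
  "hTW G \<U> h X = (hT G \<U> h X)\<lparr>carrier :=
     {a \<in> carrier (hT G \<U> h X). \<forall>w\<in>carrier (weyl G). weylT G \<U> h X w a = a}\<rparr>"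


section \<open>Coefficient ring and double structure sheaves\<close>

text \<open>\<open>S\<close>, modelled as a formal group ring, with its classes \<open>x_\<lambda>\<close> and its Weyl group action
  \<open>w(x_\<lambda>) = x_{w(\<lambda>)}\<close>.\<close>

definition coeff_ring ::
  "'k::field alg_group \<Rightarrow> bool \<Rightarrow> ('k, 'x) oct \<Rightarrow> (nat \<Rightarrow> nat \<Rightarrow> 'x) \<Rightarrow> ('k character, 'x) series set ring" where
  "coeff_ring G fin h F = formal_group_ring fin (hr h Pt) F (chars G)"

definition xcls ::
  "'k::field alg_group \<Rightarrow> bool \<Rightarrow> ('k, 'x) oct \<Rightarrow> (nat \<Rightarrow> nat \<Rightarrow> 'x) \<Rightarrow> 'k character \<Rightarrow> ('k character, 'x) series set" where
  "xcls G fin h F \<chi> = fgr_class fin (hr h Pt) F (chars G) (series_var (hr h Pt) \<chi>)"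

definition weyl_mono :: "'k::field alg_group \<Rightarrow> 'k pt set \<Rightarrow> ('k character \<Rightarrow>\<^sub>0 nat) \<Rightarrow> ('k character \<Rightarrow>\<^sub>0 nat)" where
  "weyl_mono G w m = (\<Sum>\<chi>\<in>Poly_Mapping.keys m. Poly_Mapping.single (weyl_act G w \<chi>) (Poly_Mapping.lookup m \<chi>))"

definition weylS ::
  "'k::field alg_group \<Rightarrow> ('k, 'x) oct \<Rightarrow> 'k pt set \<Rightarrow> ('k character, 'x) series set \<Rightarrow> ('k character, 'x) series set" where
  "weylS G h w s = (\<lambda>f m. if Poly_Mapping.keys m \<subseteq> carrier (chars G)
      then f (weyl_mono G (inv\<^bsub>weyl G\<^esub> w) m) else \<zero>\<^bsub>hr h Pt\<^esub>) ` s"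

text \<open>The first Chern class of the line bundle \<open>L_\<chi> = U_i \<times>^T K_\<chi>\<close> on \<open>U_i/T\<close>.\<close>

definition line_class ::
  "'k::field alg_group \<Rightarrow> 'k rep_system \<Rightarrow> ('k, 'x) oct \<Rightarrow> 'k character \<Rightarrow> nat \<Rightarrow> 'x" where
  "line_class G \<U> h \<chi> = pullT G \<U> h gpoint (gline \<chi>) (\<lambda>_. avec [0])
     (pushT G \<U> h gpoint (gline \<chi>) (\<lambda>_. avec [0]) \<one>\<^bsub>hT G \<U> h gpoint\<^esub>)"

definition series_value ::
  "'k::field alg_group \<Rightarrow> 'k rep_system \<Rightarrow> ('k, 'x) oct \<Rightarrow> ('k character, 'x) series \<Rightarrow> nat \<Rightarrow> nat \<Rightarrow> 'x" where
  "series_value G \<U> h f n i = (let Z = borel_space G \<U> gpoint i in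
     \<Oplus>\<^bsub>hr h Z\<^esub>m\<in>{m. f m \<noteq> \<zero>\<^bsub>hr h Pt\<^esub> \<and> mono_degree m < n}.
        pull h Z Pt (\<lambda>_. []) (f m) \<otimes>\<^bsub>hr h Z\<^esub>
        (\<Otimes>\<^bsub>hr h Z\<^esub>\<chi>\<in>Poly_Mapping.keys m. line_class G \<U> h \<chi> i [^]\<^bsub>hr h Z\<^esub> Poly_Mapping.lookup m \<chi>))"

text \<open>The canonical map \<open>S \<rightarrow> h_T(pt)\<close> sending \<open>x_\<chi>\<close> to the first Chern class of \<open>L_\<chi>\<close>.
  At each level \<open>i\<close>, monomials of high degree in Chern classes vanish.\<close>

definition chern_map ::
  "'k::field alg_group \<Rightarrow> 'k rep_system \<Rightarrow> ('k, 'x) oct \<Rightarrow> ('k character, 'x) series set \<Rightarrow> nat \<Rightarrow> 'x" where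
  "chern_map G \<U> h s = (\<lambda>i. THE a. \<exists>n0. \<forall>n\<ge>n0. a = series_value G \<U> h (SOME f. f \<in> s) n i)"

definition chern_complete ::
  "'k::field alg_group \<Rightarrow> 'k rep_system \<Rightarrow> bool \<Rightarrow> ('k, 'x) oct \<Rightarrow> (nat \<Rightarrow> nat \<Rightarrow> 'x) \<Rightarrow> bool" where
  "chern_complete G \<U> fin h F \<longleftrightarrow> (fin \<longrightarrow> finite {(i, j). F i j \<noteq> \<zero>\<^bsub>hr h Pt\<^esub>}) \<and>
     chern_map G \<U> h \<in> ring_iso (coeff_ring G fin h F) (hT G \<U> h gpoint)"

definition sigma_regular :: "'k::field alg_group \<Rightarrow> bool \<Rightarrow> ('k, 'x) oct \<Rightarrow> (nat \<Rightarrow> nat \<Rightarrow> 'x) \<Rightarrow> bool" where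
  "sigma_regular G fin h F \<longleftrightarrow> (\<forall>\<alpha>\<in>roots G. \<forall>s\<in>carrier (coeff_ring G fin h F).
     xcls G fin h F \<alpha> \<otimes>\<^bsub>coeff_ring G fin h F\<^esub> s = \<zero>\<^bsub>coeff_ring G fin h F\<^esub> \<longrightarrow>
     s = \<zero>\<^bsub>coeff_ring G fin h F\<^esub>)"

definition sections ::
  "'k::field alg_group \<Rightarrow> bool \<Rightarrow> ('k, 'x) oct \<Rightarrow> (nat \<Rightarrow> nat \<Rightarrow> 'x) \<Rightarrow> 'k labelling \<Rightarrow>
     'k pt set \<Rightarrow> 'k pt set \<Rightarrow> ('k pt set \<Rightarrow> ('k character, 'x) series set) ring" where
  "sections G fin h F l Q P = (let S = coeff_ring G fin h F; V = min_reps G Q P in \<lparr>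
     carrier = {c \<in> V \<rightarrow>\<^sub>E carrier S.
       (\<forall>u\<in>V. \<forall>w\<in>stab_weyl G Q P u. weylS G h w (c u) = c u) \<and>
       (\<forall>(u, u')\<in>edges G Q P. let \<alpha> = l Q P u u';
          w = (THE w. w \<in> stab_min_reps G Q P u' \<and>
            (\<exists>v\<in>parabolic_weyl G P. reflection G \<alpha> \<otimes>\<^bsub>weyl G\<^esub> u = w \<otimes>\<^bsub>weyl G\<^esub> u' \<otimes>\<^bsub>weyl G\<^esub> v))
          in \<exists>s\<in>carrier S. c u \<ominus>\<^bsub>S\<^esub> weylS G h w (c u') = xcls G fin h F \<alpha> \<otimes>\<^bsub>S\<^esub> s)},
     monoid.mult = (\<lambda>c d. \<lambda>u\<in>V. c u \<otimes>\<^bsub>S\<^esub> d u),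
     one = (\<lambda>u\<in>V. \<one>\<^bsub>S\<^esub>),
     ring.zero = (\<lambda>u\<in>V. \<zero>\<^bsub>S\<^esub>),
     add = (\<lambda>c d. \<lambda>u\<in>V. c u \<oplus>\<^bsub>S\<^esub> d u)\<rparr>)"

definition flag2 :: "'k::field alg_group \<Rightarrow> 'k pt set \<Rightarrow> 'k pt set \<Rightarrow> 'k gvariety" where
  "flag2 G Q P = gprod (flag G Q) (flag G P)"

definition flag3 :: "'k::field alg_group \<Rightarrow> 'k pt set \<Rightarrow> 'k pt set \<Rightarrow> 'k pt set \<Rightarrow> 'k gvariety" where
  "flag3 G Q P H = gprod (flag G Q) (gprod (flag G P) (flag G H))"

definition fixed_point :: "'k::field alg_group \<Rightarrow> 'k pt set \<Rightarrow> 'k pt set \<Rightarrow> 'k pt set \<Rightarrow> 'k pt" where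
  "fixed_point G Q P u = snd (coset_space G Q) \<one>\<^bsub>gmon G\<^esub> @ snd (coset_space G P) (SOME n. n \<in> u)"

definition localize ::
  "'k::field alg_group \<Rightarrow> 'k rep_system \<Rightarrow> bool \<Rightarrow> ('k, 'x) oct \<Rightarrow> (nat \<Rightarrow> nat \<Rightarrow> 'x) \<Rightarrow>
     'k pt set \<Rightarrow> 'k pt set \<Rightarrow> (nat \<Rightarrow> 'x) \<Rightarrow> 'k pt set \<Rightarrow> ('k character, 'x) series set" where
  "localize G \<U> fin h F Q P a = (\<lambda>u\<in>min_reps G Q P.
     inv_into (carrier (coeff_ring G fin h F)) (chern_map G \<U> h)
       (pullT G \<U> h gpoint (flag2 G Q P) (\<lambda>_. fixed_point G Q P u) a))"


section \<open>Motives\<close>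

text \<open>\<open>corr_comp G \<U> h Q P H \<psi> \<phi>\<close> is \<open>\<psi> \<circ> \<phi>\<close> for \<open>\<phi>: [G/Q] \<rightarrow> [G/P]\<close> and \<open>\<psi>: [G/P] \<rightarrow> [G/H]\<close>. The identity
  \<open>corr_id\<close> is the class of the diagonal.\<close>

definition corr_comp ::
  "'k::field alg_group \<Rightarrow> 'k rep_system \<Rightarrow> ('k, 'x) oct \<Rightarrow> 'k pt set \<Rightarrow> 'k pt set \<Rightarrow> 'k pt set \<Rightarrow>
     (nat \<Rightarrow> 'x) \<Rightarrow> (nat \<Rightarrow> 'x) \<Rightarrow> nat \<Rightarrow> 'x" where
  "corr_comp G \<U> h Q P H \<psi> \<phi> =
     (let q = length (dims (gsp (flag G Q))); p = length (dims (gsp (flag G P))) in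
      pushT G \<U> h (flag3 G Q P H) (flag2 G Q H) (\<lambda>x. take q x @ drop (q + p) x)
        (pullT G \<U> h (flag3 G Q P H) (flag2 G P H) (drop q) \<psi> \<otimes>\<^bsub>hT G \<U> h (flag3 G Q P H)\<^esub>
         pullT G \<U> h (flag3 G Q P H) (flag2 G Q P) (take (q + p)) \<phi>))"

definition corr_id ::
  "'k::field alg_group \<Rightarrow> 'k rep_system \<Rightarrow> ('k, 'x) oct \<Rightarrow> 'k pt set \<Rightarrow> nat \<Rightarrow> 'x" where
  "corr_id G \<U> h P = pushT G \<U> h (flag G P) (flag2 G P P) (\<lambda>x. x @ x) \<one>\<^bsub>hT G \<U> h (flag G P)\<^esub>"

text \<open>Morphism groups are rings only so that the library's additive notation is available: their
  multiplication plays no role. \<open>cmp A B C g f\<close> is the composite of \<open>f: A \<rightarrow> B\<close> and \<open>g: B \<rightarrow> C\<close>.\<close>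

definition preadditive_category ::
  "'o set \<Rightarrow> ('o \<Rightarrow> 'o \<Rightarrow> 'm ring) \<Rightarrow> ('o \<Rightarrow> 'o \<Rightarrow> 'o \<Rightarrow> 'm \<Rightarrow> 'm \<Rightarrow> 'm) \<Rightarrow> ('o \<Rightarrow> 'm) \<Rightarrow> bool" where
  "preadditive_category Ob Hom cmp idt \<longleftrightarrow>
     (\<forall>A\<in>Ob. \<forall>B\<in>Ob. abelian_group (Hom A B)) \<and>
     (\<forall>A\<in>Ob. idt A \<in> carrier (Hom A A)) \<and>
     (\<forall>A\<in>Ob. \<forall>B\<in>Ob. \<forall>C\<in>Ob. \<forall>f\<in>carrier (Hom A B). \<forall>g\<in>carrier (Hom B C).
        cmp A B C g f \<in> carrier (Hom A C) \<and>
        (\<forall>f'\<in>carrier (Hom A B). cmp A B C g (f \<oplus>\<^bsub>Hom A B\<^esub> f') = cmp A B C g f \<oplus>\<^bsub>Hom A C\<^esub> cmp A B C g f') \<and>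
        (\<forall>g'\<in>carrier (Hom B C). cmp A B C (g \<oplus>\<^bsub>Hom B C\<^esub> g') f = cmp A B C g f \<oplus>\<^bsub>Hom A C\<^esub> cmp A B C g' f)) \<and>
     (\<forall>A\<in>Ob. \<forall>B\<in>Ob. \<forall>f\<in>carrier (Hom A B). cmp A A B f (idt A) = f \<and> cmp A B B (idt B) f = f) \<and>
     (\<forall>A\<in>Ob. \<forall>B\<in>Ob. \<forall>C\<in>Ob. \<forall>D\<in>Ob. \<forall>f\<in>carrier (Hom A B). \<forall>g\<in>carrier (Hom B C). \<forall>k\<in>carrier (Hom C D).
        cmp A C D k (cmp A B C g f) = cmp A B D (cmp B C D k g) f)"

text \<open>
  The additive category generated by a preadditive category: objects are lists, standing for formal
  direct sums of their entries, and morphisms are matrices.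
\<close>

definition mat_hom :: "('o \<Rightarrow> 'o \<Rightarrow> 'm ring) \<Rightarrow> 'o list \<Rightarrow> 'o list \<Rightarrow> (nat \<times> nat \<Rightarrow> 'm) set" where
  "mat_hom Hom As Bs =
     (\<Pi>\<^sub>E (i, j)\<in>{..<length As} \<times> {..<length Bs}. carrier (Hom (As ! i) (Bs ! j)))"

definition mat_comp ::
  "('o \<Rightarrow> 'o \<Rightarrow> 'm ring) \<Rightarrow> ('o \<Rightarrow> 'o \<Rightarrow> 'o \<Rightarrow> 'm \<Rightarrow> 'm \<Rightarrow> 'm) \<Rightarrow> 'o list \<Rightarrow> 'o list \<Rightarrow> 'o list \<Rightarrow>
     (nat \<times> nat \<Rightarrow> 'm) \<Rightarrow> (nat \<times> nat \<Rightarrow> 'm) \<Rightarrow> nat \<times> nat \<Rightarrow> 'm" where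
  "mat_comp Hom cmp As Bs Cs g f = (\<lambda>(i, l)\<in>{..<length As} \<times> {..<length Cs}.
     \<Oplus>\<^bsub>Hom (As ! i) (Cs ! l)\<^esub>j\<in>{..<length Bs}. cmp (As ! i) (Bs ! j) (Cs ! l) (g (j, l)) (f (i, j)))"

definition end_ring ::
  "('o \<Rightarrow> 'o \<Rightarrow> 'm ring) \<Rightarrow> ('o \<Rightarrow> 'o \<Rightarrow> 'o \<Rightarrow> 'm \<Rightarrow> 'm \<Rightarrow> 'm) \<Rightarrow> ('o \<Rightarrow> 'm) \<Rightarrow> 'o list \<Rightarrow> (nat \<times> nat \<Rightarrow> 'm) ring" where
  "end_ring Hom cmp idt As = (let I = {..<length As} \<times> {..<length As} in \<lparr>
     carrier = mat_hom Hom As As,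
     monoid.mult = mat_comp Hom cmp As As As,
     one = (\<lambda>(i, j)\<in>I. if i = j then idt (As ! i) else \<zero>\<^bsub>Hom (As ! i) (As ! j)\<^esub>),
     ring.zero = (\<lambda>(i, j)\<in>I. \<zero>\<^bsub>Hom (As ! i) (As ! j)\<^esub>),
     add = (\<lambda>f g. \<lambda>(i, j)\<in>I. f (i, j) \<oplus>\<^bsub>Hom (As ! i) (As ! j)\<^esub> g (i, j))\<rparr>)"

definition motive_hom ::
  "'k::field alg_group \<Rightarrow> 'k rep_system \<Rightarrow> ('k, 'x) oct \<Rightarrow> 'k pt set \<Rightarrow> 'k pt set \<Rightarrow> (nat \<Rightarrow> 'x) ring" where
  "motive_hom G \<U> h Q P = hTW G \<U> h (flag2 G Q P)"

definition motive_end ::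
  "'k::field alg_group \<Rightarrow> 'k rep_system \<Rightarrow> ('k, 'x) oct \<Rightarrow> 'k pt set list \<Rightarrow> (nat \<times> nat \<Rightarrow> nat \<Rightarrow> 'x) ring" where
  "motive_end G \<U> h Ps = end_ring (motive_hom G \<U> h) (corr_comp G \<U> h) (corr_id G \<U> h) Ps"


section \<open>The total double structure sheaf with the correspondence product\<close>

definition unlocalize ::
  "'k::field alg_group \<Rightarrow> 'k rep_system \<Rightarrow> bool \<Rightarrow> ('k, 'x) oct \<Rightarrow> (nat \<Rightarrow> nat \<Rightarrow> 'x) \<Rightarrow>
     'k pt set \<Rightarrow> 'k pt set \<Rightarrow> ('k pt set \<Rightarrow> ('k character, 'x) series set) \<Rightarrow> nat \<Rightarrow> 'x" where
  "unlocalize G \<U> fin h F Q P =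
     inv_into (carrier (motive_hom G \<U> h Q P)) (localize G \<U> fin h F Q P)"

definition section_comp ::
  "'k::field alg_group \<Rightarrow> 'k rep_system \<Rightarrow> bool \<Rightarrow> ('k, 'x) oct \<Rightarrow> (nat \<Rightarrow> nat \<Rightarrow> 'x) \<Rightarrow>
     'k pt set \<Rightarrow> 'k pt set \<Rightarrow> 'k pt set \<Rightarrow> ('k pt set \<Rightarrow> ('k character, 'x) series set) \<Rightarrow>
     ('k pt set \<Rightarrow> ('k character, 'x) series set) \<Rightarrow> 'k pt set \<Rightarrow> ('k character, 'x) series set" where
  "section_comp G \<U> fin h F Q P H d c = localize G \<U> fin h F Q H
     (corr_comp G \<U> h Q P H (unlocalize G \<U> fin h F P H d) (unlocalize G \<U> fin h F Q P c))"

definition total_sections ::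
  "'k::field alg_group \<Rightarrow> 'k rep_system \<Rightarrow> bool \<Rightarrow> ('k, 'x) oct \<Rightarrow> (nat \<Rightarrow> nat \<Rightarrow> 'x) \<Rightarrow> 'k labelling \<Rightarrow>
     ('k pt set \<times> 'k pt set \<Rightarrow> 'k pt set \<Rightarrow> ('k character, 'x) series set) ring" where
  "total_sections G \<U> fin h F l =
     (let \<P> = parabolics G; \<Gamma> = sections G fin h F l in \<lparr>
     carrier = (\<Pi>\<^sub>E (Q, P)\<in>\<P> \<times> \<P>. carrier (\<Gamma> Q P)),
     monoid.mult = (\<lambda>d c. \<lambda>(Q, H)\<in>\<P> \<times> \<P>.
       \<Oplus>\<^bsub>\<Gamma> Q H\<^esub>P\<in>\<P>. section_comp G \<U> fin h F Q P H (d (P, H)) (c (Q, P))),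
     one = (\<lambda>(Q, P)\<in>\<P> \<times> \<P>. if Q = P then localize G \<U> fin h F Q Q (corr_id G \<U> h Q) else \<zero>\<^bsub>\<Gamma> Q P\<^esub>),
     ring.zero = (\<lambda>(Q, P)\<in>\<P> \<times> \<P>. \<zero>\<^bsub>\<Gamma> Q P\<^esub>),
     add = (\<lambda>c d. \<lambda>(Q, P)\<in>\<P> \<times> \<P>. c (Q, P) \<oplus>\<^bsub>\<Gamma> Q P\<^esub> d (Q, P))\<rparr>)"

end

theory Submission
  imports Defs
begin

text \<open>
  An endomorphism of \<open>[X] = \<Oplus>\<^sub>P [G/P]\<close> is a matrix of invariant classes on the \<open>G/Q \<times> G/P\<close>, and
  localization at the fixed points, applied entrywise, carries it to a family of sections.
  As the product of sections is transported along localization and composition is biadditive,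
  matrix multiplication becomes the product on \<open>\<Gamma>(O)\<close>. Numbering the parabolics by \<open>Ps\<close> only
  reindexes the sums.
\<close>

text \<open>The definition of \<open>total_sections\<close> brings no ring axioms with it, and even
  \<open>sections\<close> is not visibly a group: a direct check would have to follow the
  \<open>weylS\<close> invariance and the divisibility conditions through the quotient. All these
  axioms are therefore transported from the motivic side, where the matrices over a preadditive
  category form a ring. One thing does not travel. A bijection compatible with addition says nothing
  about the constant declared as zero of a structure that is not yet known to be a monoid. For
  sections the constant is recovered from idempotence, componentwise in \<open>coeff_ring\<close>.
  This is why the additive group of \<open>coeff_ring\<close> has to be built first, from the
  cohomology of the point through the series to the quotient by the closed ideal of
  relations.\<close>

section \<open>Additive maps, finite sums and transport of structure\<close>

lemma group_hom_add_monoid: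
  assumes "abelian_group A" "abelian_group B" "f \<in> hom (add_monoid A) (add_monoid B)"
  shows "group_hom (add_monoid A) (add_monoid B) f"
  using assms by (simp add: group_hom_def group_hom_axioms_def abelian_group.a_group)

lemma additive_hom_zero:
  assumes "abelian_group A" "abelian_group B" "f \<in> hom (add_monoid A) (add_monoid B)"
  shows "f \<zero>\<^bsub>A\<^esub> = \<zero>\<^bsub>B\<^esub>"
  using group_hom.hom_one[OF group_hom_add_monoid[OF assms]] by simp

text \<open>The index set is arbitrary because a \<open>finsum\<close> over an infinite set defaults
  to zero, and cancellation in the target group forces an additive map to preserve zero.\<close>

lemma additive_hom_finsum:
  assumes A: "abelian_group A" and B: "abelian_group B"
    and f: "f \<in> hom (add_monoid A) (add_monoid B)" and g: "g \<in> I \<rightarrow> carrier A"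
  shows "f (\<Oplus>\<^bsub>A\<^esub>i\<in>I. g i) = (\<Oplus>\<^bsub>B\<^esub>i\<in>I. f (g i))"
proof -
  interpret A: abelian_group A by (rule A)
  interpret B: abelian_group B by (rule B)
  have closed: "f x \<in> carrier B" if "x \<in> carrier A" for x
    using f that by (auto simp: hom_def)
  have add: "f (x \<oplus>\<^bsub>A\<^esub> y) = f x \<oplus>\<^bsub>B\<^esub> f y" if "x \<in> carrier A" "y \<in> carrier A" for x y
    using f that by (auto simp: hom_def)
  show ?thesis
    using g
  proof (induction I rule: infinite_finite_induct)
    case (infinite I)
    then show ?case
      by (simp add: A.finsum_infinite B.finsum_infinite additive_hom_zero[OF A B f])
  next
    case empty
    show ?case by (simp add: additive_hom_zero[OF A B f])
  next
    case (insert i I)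
    then have gI: "g \<in> I \<rightarrow> carrier A" and gi: "g i \<in> carrier A" by auto
    have "(\<lambda>i. f (g i)) \<in> I \<rightarrow> carrier B" using gI closed by auto
    then show ?case
      using insert gI gi by (simp add: A.finsum_insert B.finsum_insert add closed)
  qed
qed

lemma (in abelian_monoid) finsum_swap:
  assumes "finite I" and "finite J" and "\<And>i j. i \<in> I \<Longrightarrow> j \<in> J \<Longrightarrow> f i j \<in> carrier G"
  shows "(\<Oplus>i\<in>I. \<Oplus>j\<in>J. f i j) = (\<Oplus>j\<in>J. \<Oplus>i\<in>I. f i j)"
  using assms(1,3)
proof (induction I)
  case empty
  then show ?case by simp
next
  case (insert i I)
  have "(\<Oplus>i\<in>insert i I. \<Oplus>j\<in>J. f i j) = (\<Oplus>j\<in>J. f i j) \<oplus> (\<Oplus>i\<in>I. \<Oplus>j\<in>J. f i j)"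
    using insert by (intro finsum_insert) auto
  also have "\<dots> = (\<Oplus>j\<in>J. f i j) \<oplus> (\<Oplus>j\<in>J. \<Oplus>i\<in>I. f i j)"
    using insert by simp
  also have "\<dots> = (\<Oplus>j\<in>J. f i j \<oplus> (\<Oplus>i\<in>I. f i j))"
    using insert by (intro finsum_addf[symmetric]) auto
  also have "\<dots> = (\<Oplus>j\<in>J. \<Oplus>i\<in>insert i I. f i j)"
    using insert by (intro finsum_cong') auto
  finally show ?case .
qed

text \<open>Transport along \<open>f\<close> yields a group whose unit is the image of zero. The
  assumption \<open>zero\<close> identifies that unit with the constant that \<open>B\<close>
  declares.\<close>

lemma iso_abelian_group:
  assumes A: "abelian_group A" and f: "f \<in> iso (add_monoid A) (add_monoid B)"
    and zero: "f \<zero>\<^bsub>A\<^esub> = \<zero>\<^bsub>B\<^esub>"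
  shows "abelian_group B"
proof -
  have "comm_group ((add_monoid B)\<lparr>one := f \<zero>\<^bsub>A\<^esub>\<rparr>)"
    using comm_group.iso_imp_img_comm_group[OF abelian_group.a_comm_group[OF A] f] by simp
  then show ?thesis
    by (intro comm_group_abelian_groupI) (simp add: zero)
qed

text \<open>In the application \<open>k\<close> sends a pair of parabolics to a pair of list
  positions and \<open>f\<close> is localization. With \<open>X\<close> indexed by \<open>A\<close>
  and \<open>Y\<close> by \<open>B\<close>, one map both renumbers the entries of a matrix and
  localizes them.\<close>

lemma bij_betw_PiE:
  assumes k: "bij_betw k B A" and f: "\<And>x. x \<in> B \<Longrightarrow> bij_betw (f x) (X (k x)) (Y x)"
  shows "bij_betw (\<lambda>p. \<lambda>x\<in>B. f x (p (k x))) (PiE A X) (PiE B Y)"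
\<comment> \<open>The inverse reads the entry at the unique \<open>x\<close> over \<open>a\<close>
  and takes it back through \<open>f x\<close>.\<close>
proof (rule bij_betw_byWitness[where f' = "\<lambda>q. \<lambda>a\<in>A. let x = inv_into B k a in inv_into (X a) (f x) (q x)"])
  have ik: "inv_into B k a \<in> B" "k (inv_into B k a) = a" if "a \<in> A" for a
    using k that by (auto simp: bij_betw_def inv_into_into f_inv_into_f)
  have ki: "inv_into B k (k x) = x" "k x \<in> A" if "x \<in> B" for x
    using k that by (auto simp: bij_betw_def)
  have fX: "f x a \<in> Y x" "inv_into (X (k x)) (f x) (f x a) = a" if "x \<in> B" "a \<in> X (k x)" for x a
    using f[OF that(1)] that by (auto simp: bij_betw_def)
  have fY: "inv_into (X (k x)) (f x) b \<in> X (k x)" "f x (inv_into (X (k x)) (f x) b) = b"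
    if "x \<in> B" "b \<in> Y x" for x b
    using f[OF that(1)] that by (auto simp: bij_betw_def inv_into_into f_inv_into_f)
  show "\<forall>p\<in>PiE A X. (\<lambda>a\<in>A. let x = inv_into B k a in inv_into (X a) (f x) ((\<lambda>x\<in>B. f x (p (k x))) x)) = p"
  proof (intro ballI ext)
    fix p a assume p: "p \<in> PiE A X"
    show "(\<lambda>a\<in>A. let x = inv_into B k a in inv_into (X a) (f x) ((\<lambda>x\<in>B. f x (p (k x))) x)) a = p a"
      using fX(2)[OF ik(1)[of a], of "p a"] ik[of a] p by (cases "a \<in> A") (auto simp: Let_def)
  qed
  show "\<forall>q\<in>PiE B Y. (\<lambda>x\<in>B. f x ((\<lambda>a\<in>A. let x = inv_into B k a in inv_into (X a) (f x) (q x)) (k x))) = q"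
  proof (intro ballI ext)
    fix q x assume q: "q \<in> PiE B Y"
    show "(\<lambda>x\<in>B. f x ((\<lambda>a\<in>A. let x = inv_into B k a in inv_into (X a) (f x) (q x)) (k x))) x = q x"
      using fY(2)[of x "q x"] ki[of x] q by (cases "x \<in> B") (auto simp: Let_def)
  qed
  show "(\<lambda>p. \<lambda>x\<in>B. f x (p (k x))) ` PiE A X \<subseteq> PiE B Y"
    using ki(2) fX(1) by (auto simp: PiE_mem)
  show "(\<lambda>q. \<lambda>a\<in>A. let x = inv_into B k a in inv_into (X a) (f x) (q x)) ` PiE B Y \<subseteq> PiE A X"
    using ik fY(1) by (fastforce simp: Let_def PiE_mem)
qed

section \<open>The endomorphism ring of a formal direct sum in a preadditive category\<close>

locale preadditive =
  fixes Ob :: "'o set" and Hom :: "'o \<Rightarrow> 'o \<Rightarrow> 'm ring"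
    and cmp :: "'o \<Rightarrow> 'o \<Rightarrow> 'o \<Rightarrow> 'm \<Rightarrow> 'm \<Rightarrow> 'm" and idt :: "'o \<Rightarrow> 'm"
  assumes category: "preadditive_category Ob Hom cmp idt"
begin

lemma Hom_group: "A \<in> Ob \<Longrightarrow> B \<in> Ob \<Longrightarrow> abelian_group (Hom A B)"
  using category unfolding preadditive_category_def by blast

lemma idt_closed: "A \<in> Ob \<Longrightarrow> idt A \<in> carrier (Hom A A)"
  using category unfolding preadditive_category_def by blast

lemma cmp_idt:
  assumes "A \<in> Ob" "B \<in> Ob" "f \<in> carrier (Hom A B)"
  shows "cmp A A B f (idt A) = f" and "cmp A B B (idt B) f = f"
  using category assms unfolding preadditive_category_def by blast+

lemma cmp_assoc:
  assumes "A \<in> Ob" "B \<in> Ob" "C \<in> Ob" "D \<in> Ob"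
    and "f \<in> carrier (Hom A B)" "g \<in> carrier (Hom B C)" "k \<in> carrier (Hom C D)"
  shows "cmp A C D k (cmp A B C g f) = cmp A B D (cmp B C D k g) f"
proof -
  have "\<forall>A\<in>Ob. \<forall>B\<in>Ob. \<forall>C\<in>Ob. \<forall>D\<in>Ob. \<forall>f\<in>carrier (Hom A B). \<forall>g\<in>carrier (Hom B C). \<forall>k\<in>carrier (Hom C D).
        cmp A C D k (cmp A B C g f) = cmp A B D (cmp B C D k g) f"
    using category unfolding preadditive_category_def by blast
  then show ?thesis using assms by blast
qed

lemma cmp_closed:
  assumes "A \<in> Ob" "B \<in> Ob" "C \<in> Ob" "f \<in> carrier (Hom A B)" "g \<in> carrier (Hom B C)"
  shows "cmp A B C g f \<in> carrier (Hom A C)"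
  using category assms unfolding preadditive_category_def by blast

lemma cmp_add_right:
  assumes "A \<in> Ob" "B \<in> Ob" "C \<in> Ob" "g \<in> carrier (Hom B C)"
    and "f \<in> carrier (Hom A B)" "f' \<in> carrier (Hom A B)"
  shows "cmp A B C g (f \<oplus>\<^bsub>Hom A B\<^esub> f') = cmp A B C g f \<oplus>\<^bsub>Hom A C\<^esub> cmp A B C g f'"
  using category assms unfolding preadditive_category_def by blast

lemma cmp_add_left:
  assumes "A \<in> Ob" "B \<in> Ob" "C \<in> Ob" "f \<in> carrier (Hom A B)"
    and "g \<in> carrier (Hom B C)" "g' \<in> carrier (Hom B C)"
  shows "cmp A B C (g \<oplus>\<^bsub>Hom B C\<^esub> g') f = cmp A B C g f \<oplus>\<^bsub>Hom A C\<^esub> cmp A B C g' f"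
  using category assms unfolding preadditive_category_def by blast

text \<open>Biadditivity is phrased as two homomorphisms of additive monoids so that composition
  commutes with zero and with \<open>finsum\<close> by the general lemmas above.\<close>

lemma cmp_hom_left:
  assumes "A \<in> Ob" "B \<in> Ob" "C \<in> Ob" "g \<in> carrier (Hom B C)"
  shows "cmp A B C g \<in> hom (add_monoid (Hom A B)) (add_monoid (Hom A C))"
  using assms by (simp add: hom_def cmp_closed cmp_add_right)

lemma cmp_hom_right:
  assumes "A \<in> Ob" "B \<in> Ob" "C \<in> Ob" "f \<in> carrier (Hom A B)"
  shows "(\<lambda>g. cmp A B C g f) \<in> hom (add_monoid (Hom B C)) (add_monoid (Hom A C))"
  using assms by (simp add: hom_def cmp_closed cmp_add_left)

lemma cmp_zero:
  assumes "A \<in> Ob" "B \<in> Ob" "C \<in> Ob"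
  shows "f \<in> carrier (Hom A B) \<Longrightarrow> cmp A B C \<zero>\<^bsub>Hom B C\<^esub> f = \<zero>\<^bsub>Hom A C\<^esub>"
    and "g \<in> carrier (Hom B C) \<Longrightarrow> cmp A B C g \<zero>\<^bsub>Hom A B\<^esub> = \<zero>\<^bsub>Hom A C\<^esub>"
  using additive_hom_zero[OF _ _ cmp_hom_right, of B C A f]
    additive_hom_zero[OF _ _ cmp_hom_left, of A B C g] assms
  by (auto simp: Hom_group)

context
  fixes As :: "'o list"
  assumes As: "set As \<subseteq> Ob"
begin

lemma As_nth: "i < length As \<Longrightarrow> As ! i \<in> Ob"
  using As by auto

abbreviation E where "E \<equiv> end_ring Hom cmp idt As"

lemma end_closed:
  assumes "f \<in> carrier E" "i < length As" "j < length As"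
  shows "f (i, j) \<in> carrier (Hom (As ! i) (As ! j))"
  using assms by (auto simp: end_ring_def Let_def mat_hom_def dest: PiE_mem)

lemma end_memI:
  assumes "\<And>i j. i < length As \<Longrightarrow> j < length As \<Longrightarrow> f (i, j) \<in> carrier (Hom (As ! i) (As ! j))"
    and "f \<in> extensional ({..<length As} \<times> {..<length As})"
  shows "f \<in> carrier E"
  using assms by (auto simp: end_ring_def Let_def mat_hom_def PiE_iff)

lemma end_eqI:
  assumes "f \<in> carrier E" "g \<in> carrier E"
    and "\<And>i j. i < length As \<Longrightarrow> j < length As \<Longrightarrow> f (i, j) = g (i, j)"
  shows "f = g"
  using assms by (intro extensionalityI[where A = "{..<length As} \<times> {..<length As}"])
    (auto simp: end_ring_def Let_def mat_hom_def PiE_iff)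

lemma end_add_apply:
  "i < length As \<Longrightarrow> j < length As \<Longrightarrow>
    (f \<oplus>\<^bsub>E\<^esub> g) (i, j) = f (i, j) \<oplus>\<^bsub>Hom (As ! i) (As ! j)\<^esub> g (i, j)"
  by (simp add: end_ring_def Let_def)

lemma end_zero_apply:
  "i < length As \<Longrightarrow> j < length As \<Longrightarrow> \<zero>\<^bsub>E\<^esub> (i, j) = \<zero>\<^bsub>Hom (As ! i) (As ! j)\<^esub>"
  by (simp add: end_ring_def Let_def)

lemma end_one_apply:
  "i < length As \<Longrightarrow> j < length As \<Longrightarrow>
    \<one>\<^bsub>E\<^esub> (i, j) = (if i = j then idt (As ! i) else \<zero>\<^bsub>Hom (As ! i) (As ! j)\<^esub>)"
  by (simp add: end_ring_def Let_def)

text \<open>The first index is the source and the second the target, so indices run in the order of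
  the arrows: \<open>f (i, j)\<close> is applied first, and the matrices are the transposes of the
  usual ones.\<close>

lemma end_mult_apply:
  "i < length As \<Longrightarrow> l < length As \<Longrightarrow>
    (g \<otimes>\<^bsub>E\<^esub> f) (i, l) = (\<Oplus>\<^bsub>Hom (As ! i) (As ! l)\<^esub>j\<in>{..<length As}.
      cmp (As ! i) (As ! j) (As ! l) (g (j, l)) (f (i, j)))"
  by (simp add: end_ring_def Let_def mat_comp_def)

lemma end_add_closed:
  assumes "f \<in> carrier E" "g \<in> carrier E"
  shows "f \<oplus>\<^bsub>E\<^esub> g \<in> carrier E"
proof (rule end_memI)
  show "f \<oplus>\<^bsub>E\<^esub> g \<in> extensional ({..<length As} \<times> {..<length As})"
    by (simp add: end_ring_def Let_def)
  fix i j assume ij: "i < length As" "j < length As"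
  interpret abelian_group "Hom (As ! i) (As ! j)"
    using ij by (intro Hom_group As_nth)
  show "(f \<oplus>\<^bsub>E\<^esub> g) (i, j) \<in> carrier (Hom (As ! i) (As ! j))"
    using assms ij by (simp add: end_add_apply end_closed)
qed

lemma end_zero_closed: "\<zero>\<^bsub>E\<^esub> \<in> carrier E"
proof (rule end_memI)
  show "\<zero>\<^bsub>E\<^esub> \<in> extensional ({..<length As} \<times> {..<length As})"
    by (simp add: end_ring_def Let_def)
  fix i j assume ij: "i < length As" "j < length As"
  then show "\<zero>\<^bsub>E\<^esub> (i, j) \<in> carrier (Hom (As ! i) (As ! j))"
    by (simp add: end_zero_apply Hom_group As_nth abelian_monoid.zero_closed abelian_group.axioms(1))
qed

lemma end_one_closed: "\<one>\<^bsub>E\<^esub> \<in> carrier E"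
proof (rule end_memI)
  show "\<one>\<^bsub>E\<^esub> \<in> extensional ({..<length As} \<times> {..<length As})"
    by (simp add: end_ring_def Let_def)
  fix i j assume ij: "i < length As" "j < length As"
  then show "\<one>\<^bsub>E\<^esub> (i, j) \<in> carrier (Hom (As ! i) (As ! j))"
    by (simp add: end_one_apply Hom_group As_nth idt_closed
        abelian_monoid.zero_closed abelian_group.axioms(1))
qed

lemma end_mult_closed:
  assumes "f \<in> carrier E" "g \<in> carrier E"
  shows "g \<otimes>\<^bsub>E\<^esub> f \<in> carrier E"
proof (rule end_memI)
  show "g \<otimes>\<^bsub>E\<^esub> f \<in> extensional ({..<length As} \<times> {..<length As})"
    by (simp add: end_ring_def Let_def mat_comp_def)
  fix i j assume ij: "i < length As" "j < length As"
  interpret abelian_group "Hom (As ! i) (As ! j)"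
    using ij by (intro Hom_group As_nth)
  show "(g \<otimes>\<^bsub>E\<^esub> f) (i, j) \<in> carrier (Hom (As ! i) (As ! j))"
    using assms ij by (auto simp: end_mult_apply As_nth end_closed intro!: finsum_closed cmp_closed)
qed

lemma end_abelian_group: "abelian_group E"
proof (rule abelian_groupI)
  fix f g k assume fgk: "f \<in> carrier E" "g \<in> carrier E" "k \<in> carrier E"
  show "f \<oplus>\<^bsub>E\<^esub> g \<in> carrier E" by (intro end_add_closed fgk)
  show "f \<oplus>\<^bsub>E\<^esub> g \<oplus>\<^bsub>E\<^esub> k = f \<oplus>\<^bsub>E\<^esub> (g \<oplus>\<^bsub>E\<^esub> k)"
  proof (rule end_eqI)
    fix i j assume ij: "i < length As" "j < length As"
    interpret abelian_group "Hom (As ! i) (As ! j)"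
      using ij by (intro Hom_group As_nth)
    show "(f \<oplus>\<^bsub>E\<^esub> g \<oplus>\<^bsub>E\<^esub> k) (i, j) = (f \<oplus>\<^bsub>E\<^esub> (g \<oplus>\<^bsub>E\<^esub> k)) (i, j)"
      using fgk ij by (simp add: end_add_apply end_closed a_assoc)
  qed (intro end_add_closed fgk)+
next
  fix f g assume fg: "f \<in> carrier E" "g \<in> carrier E"
  show "f \<oplus>\<^bsub>E\<^esub> g = g \<oplus>\<^bsub>E\<^esub> f"
  proof (rule end_eqI)
    fix i j assume ij: "i < length As" "j < length As"
    interpret abelian_group "Hom (As ! i) (As ! j)"
      using ij by (intro Hom_group As_nth)
    show "(f \<oplus>\<^bsub>E\<^esub> g) (i, j) = (g \<oplus>\<^bsub>E\<^esub> f) (i, j)"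
      using fg ij by (simp add: end_add_apply end_closed a_comm)
  qed (intro end_add_closed fg)+
next
  fix f assume f: "f \<in> carrier E"
  show "\<zero>\<^bsub>E\<^esub> \<oplus>\<^bsub>E\<^esub> f = f"
  proof (rule end_eqI)
    fix i j assume ij: "i < length As" "j < length As"
    interpret abelian_group "Hom (As ! i) (As ! j)"
      using ij by (intro Hom_group As_nth)
    show "(\<zero>\<^bsub>E\<^esub> \<oplus>\<^bsub>E\<^esub> f) (i, j) = f (i, j)"
      using f ij by (simp add: end_add_apply end_zero_apply end_closed)
  qed (intro end_add_closed end_zero_closed f)+
  \<comment> \<open>The entrywise negative is restricted to the index square because matrices are
    required to be extensional.\<close>
  define g where "g = (\<lambda>(i, j)\<in>{..<length As} \<times> {..<length As}. \<ominus>\<^bsub>Hom (As ! i) (As ! j)\<^esub> f (i, j))"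
  have g: "g \<in> carrier E"
  proof (rule end_memI)
    fix i j assume ij: "i < length As" "j < length As"
    interpret abelian_group "Hom (As ! i) (As ! j)"
      using ij by (intro Hom_group As_nth)
    show "g (i, j) \<in> carrier (Hom (As ! i) (As ! j))"
      using f ij by (simp add: g_def end_closed)
  qed (simp add: g_def)
  have "g \<oplus>\<^bsub>E\<^esub> f = \<zero>\<^bsub>E\<^esub>"
  proof (rule end_eqI)
    fix i j assume ij: "i < length As" "j < length As"
    interpret abelian_group "Hom (As ! i) (As ! j)"
      using ij by (intro Hom_group As_nth)
    show "(g \<oplus>\<^bsub>E\<^esub> f) (i, j) = \<zero>\<^bsub>E\<^esub> (i, j)"
      using f ij by (simp add: end_add_apply end_zero_apply end_closed g_def l_neg)
  qed (intro end_add_closed end_zero_closed f g)+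
  then show "\<exists>g\<in>carrier E. g \<oplus>\<^bsub>E\<^esub> f = \<zero>\<^bsub>E\<^esub>" using g by blast
qed (rule end_zero_closed)

text \<open>Both sides are the same double sum over the intermediate positions \<open>j\<close> and
  \<open>l\<close>. Additivity in the left argument expands one side and additivity in the right
  argument the other; \<open>finsum_swap\<close> exchanges the sums and \<open>cmp_assoc\<close>
  matches the summands.\<close>

lemma end_mult_assoc:
  assumes fgk: "f \<in> carrier E" "g \<in> carrier E" "k \<in> carrier E"
  shows "k \<otimes>\<^bsub>E\<^esub> g \<otimes>\<^bsub>E\<^esub> f = k \<otimes>\<^bsub>E\<^esub> (g \<otimes>\<^bsub>E\<^esub> f)"
proof (rule end_eqI)
  fix i m assume im: "i < length As" "m < length As"
  note cl = end_closed[OF fgk(1)] end_closed[OF fgk(2)] end_closed[OF fgk(3)]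
    end_closed[OF end_mult_closed[OF fgk(1,2)]]
  let ?n = "{..<length As}"
  interpret abelian_group "Hom (As ! i) (As ! m)"
    using im by (intro Hom_group As_nth)
  have "(k \<otimes>\<^bsub>E\<^esub> g \<otimes>\<^bsub>E\<^esub> f) (i, m) = (\<Oplus>\<^bsub>Hom (As ! i) (As ! m)\<^esub>j\<in>?n.
      cmp (As ! i) (As ! j) (As ! m) ((k \<otimes>\<^bsub>E\<^esub> g) (j, m)) (f (i, j)))"
    using im by (rule end_mult_apply)
  also have "\<dots> = (\<Oplus>\<^bsub>Hom (As ! i) (As ! m)\<^esub>j\<in>?n. \<Oplus>\<^bsub>Hom (As ! i) (As ! m)\<^esub>l\<in>?n.
      cmp (As ! i) (As ! j) (As ! m) (cmp (As ! j) (As ! l) (As ! m) (k (l, m)) (g (j, l))) (f (i, j)))"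
  proof (rule finsum_cong')
    fix j assume j: "j \<in> ?n"
    then have j': "j < length As" by simp
    show "cmp (As ! i) (As ! j) (As ! m) ((k \<otimes>\<^bsub>E\<^esub> g) (j, m)) (f (i, j)) =
      (\<Oplus>\<^bsub>Hom (As ! i) (As ! m)\<^esub>l\<in>?n.
        cmp (As ! i) (As ! j) (As ! m) (cmp (As ! j) (As ! l) (As ! m) (k (l, m)) (g (j, l))) (f (i, j)))"
      using j im fgk unfolding end_mult_apply[OF j' im(2)]
      by (intro additive_hom_finsum[where f = "\<lambda>a. cmp (As ! i) (As ! j) (As ! m) a (f (i, j))",
            OF _ _ cmp_hom_right])
        (auto intro!: Hom_group As_nth cl cmp_closed)
  qed (use im fgk in \<open>auto intro!: finsum_closed As_nth cl cmp_closed\<close>)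
  also have "\<dots> = (\<Oplus>\<^bsub>Hom (As ! i) (As ! m)\<^esub>l\<in>?n. \<Oplus>\<^bsub>Hom (As ! i) (As ! m)\<^esub>j\<in>?n.
      cmp (As ! i) (As ! j) (As ! m) (cmp (As ! j) (As ! l) (As ! m) (k (l, m)) (g (j, l))) (f (i, j)))"
    using im fgk by (intro finsum_swap) (auto intro!: As_nth cl cmp_closed)
  also have "\<dots> = (\<Oplus>\<^bsub>Hom (As ! i) (As ! m)\<^esub>l\<in>?n.
      cmp (As ! i) (As ! l) (As ! m) (k (l, m)) ((g \<otimes>\<^bsub>E\<^esub> f) (i, l)))"
  proof (rule finsum_cong')
    fix l assume l: "l \<in> ?n"
    then have l': "l < length As" by simp
    have "cmp (As ! i) (As ! l) (As ! m) (k (l, m)) ((g \<otimes>\<^bsub>E\<^esub> f) (i, l)) =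
      (\<Oplus>\<^bsub>Hom (As ! i) (As ! m)\<^esub>j\<in>?n.
        cmp (As ! i) (As ! l) (As ! m) (k (l, m)) (cmp (As ! i) (As ! j) (As ! l) (g (j, l)) (f (i, j))))"
      using l im fgk unfolding end_mult_apply[OF im(1) l']
      by (intro additive_hom_finsum[OF _ _ cmp_hom_left])
        (auto intro!: Hom_group As_nth cl cmp_closed)
    also have "\<dots> = (\<Oplus>\<^bsub>Hom (As ! i) (As ! m)\<^esub>j\<in>?n.
        cmp (As ! i) (As ! j) (As ! m) (cmp (As ! j) (As ! l) (As ! m) (k (l, m)) (g (j, l))) (f (i, j)))"
      using l im fgk by (intro finsum_cong')
        (auto intro!: cmp_assoc As_nth cl cmp_closed)
    finally show "(\<Oplus>\<^bsub>Hom (As ! i) (As ! m)\<^esub>j\<in>?n.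
        cmp (As ! i) (As ! j) (As ! m) (cmp (As ! j) (As ! l) (As ! m) (k (l, m)) (g (j, l))) (f (i, j))) =
      cmp (As ! i) (As ! l) (As ! m) (k (l, m)) ((g \<otimes>\<^bsub>E\<^esub> f) (i, l))" ..
  qed (use im fgk in \<open>auto intro!: As_nth cl cmp_closed end_mult_closed\<close>)
  also have "\<dots> = (k \<otimes>\<^bsub>E\<^esub> (g \<otimes>\<^bsub>E\<^esub> f)) (i, m)"
    using im by (rule end_mult_apply[symmetric])
  finally show "(k \<otimes>\<^bsub>E\<^esub> g \<otimes>\<^bsub>E\<^esub> f) (i, m) = (k \<otimes>\<^bsub>E\<^esub> (g \<otimes>\<^bsub>E\<^esub> f)) (i, m)" .
qed (intro end_mult_closed fgk)+

lemma end_one_mult: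
  assumes f: "f \<in> carrier E"
  shows "\<one>\<^bsub>E\<^esub> \<otimes>\<^bsub>E\<^esub> f = f"
proof (rule end_eqI)
  fix i l assume il: "i < length As" "l < length As"
  interpret abelian_group "Hom (As ! i) (As ! l)"
    using il by (intro Hom_group As_nth)
  have "(\<one>\<^bsub>E\<^esub> \<otimes>\<^bsub>E\<^esub> f) (i, l) = (\<Oplus>\<^bsub>Hom (As ! i) (As ! l)\<^esub>j\<in>{..<length As}.
      if l = j then f (i, j) else \<zero>\<^bsub>Hom (As ! i) (As ! l)\<^esub>)"
    using il f unfolding end_mult_apply[OF il]
    by (intro finsum_cong') (auto simp: end_one_apply cmp_idt cmp_zero As_nth end_closed)
  \<comment> \<open>For \<open>j\<close> other than \<open>l\<close> the entry
    \<open>f (i, j)\<close> lies in another morphism group, which would violate the carrier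
    condition of \<open>finsum_singleton\<close>. The constant family \<open>f (i, l)\<close>
    satisfies it and has the same sum.\<close>
  also have "\<dots> = f (i, l)"
    using il f
    by (subst finsum_cong'[where g = "\<lambda>j. if l = j then f (i, l) else \<zero>\<^bsub>Hom (As ! i) (As ! l)\<^esub>"])
      (auto simp: finsum_singleton[of l _ "\<lambda>_. f (i, l)"] end_closed)
  finally show "(\<one>\<^bsub>E\<^esub> \<otimes>\<^bsub>E\<^esub> f) (i, l) = f (i, l)" .
qed (intro end_mult_closed end_one_closed f)+

lemma end_mult_one:
  assumes f: "f \<in> carrier E"
  shows "f \<otimes>\<^bsub>E\<^esub> \<one>\<^bsub>E\<^esub> = f"
proof (rule end_eqI)
  fix i l assume il: "i < length As" "l < length As"
  interpret abelian_group "Hom (As ! i) (As ! l)"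
    using il by (intro Hom_group As_nth)
  have "(f \<otimes>\<^bsub>E\<^esub> \<one>\<^bsub>E\<^esub>) (i, l) = (\<Oplus>\<^bsub>Hom (As ! i) (As ! l)\<^esub>j\<in>{..<length As}.
      if i = j then f (j, l) else \<zero>\<^bsub>Hom (As ! i) (As ! l)\<^esub>)"
    using il f unfolding end_mult_apply[OF il]
    by (intro finsum_cong') (auto simp: end_one_apply cmp_idt cmp_zero As_nth end_closed)
  also have "\<dots> = f (i, l)"
    using il f
    by (subst finsum_cong'[where g = "\<lambda>j. if i = j then f (i, l) else \<zero>\<^bsub>Hom (As ! i) (As ! l)\<^esub>"])
      (auto simp: finsum_singleton[of i _ "\<lambda>_. f (i, l)"] end_closed)
  finally show "(f \<otimes>\<^bsub>E\<^esub> \<one>\<^bsub>E\<^esub>) (i, l) = f (i, l)" .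
qed (intro end_mult_closed end_one_closed f)+

lemma end_distrib_right:
  assumes fgk: "f \<in> carrier E" "g \<in> carrier E" "k \<in> carrier E"
  shows "(f \<oplus>\<^bsub>E\<^esub> g) \<otimes>\<^bsub>E\<^esub> k = f \<otimes>\<^bsub>E\<^esub> k \<oplus>\<^bsub>E\<^esub> g \<otimes>\<^bsub>E\<^esub> k"
proof (rule end_eqI)
  fix i l assume il: "i < length As" "l < length As"
  interpret abelian_group "Hom (As ! i) (As ! l)"
    using il by (intro Hom_group As_nth)
  have "((f \<oplus>\<^bsub>E\<^esub> g) \<otimes>\<^bsub>E\<^esub> k) (i, l) = (\<Oplus>\<^bsub>Hom (As ! i) (As ! l)\<^esub>j\<in>{..<length As}.
      cmp (As ! i) (As ! j) (As ! l) (f (j, l)) (k (i, j)) \<oplus>\<^bsub>Hom (As ! i) (As ! l)\<^esub>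
      cmp (As ! i) (As ! j) (As ! l) (g (j, l)) (k (i, j)))"
    using il fgk hom_mult[OF cmp_hom_right] unfolding end_mult_apply[OF il]
    by (intro finsum_cong') (auto simp: end_add_apply As_nth end_closed cmp_closed)
  also have "\<dots> = (f \<otimes>\<^bsub>E\<^esub> k \<oplus>\<^bsub>E\<^esub> g \<otimes>\<^bsub>E\<^esub> k) (i, l)"
    using il fgk unfolding end_add_apply[OF il] end_mult_apply[OF il]
    by (intro finsum_addf) (auto simp: As_nth end_closed cmp_closed)
  finally show "((f \<oplus>\<^bsub>E\<^esub> g) \<otimes>\<^bsub>E\<^esub> k) (i, l) = (f \<otimes>\<^bsub>E\<^esub> k \<oplus>\<^bsub>E\<^esub> g \<otimes>\<^bsub>E\<^esub> k) (i, l)" .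
qed (intro end_add_closed end_mult_closed fgk)+

lemma end_distrib_left:
  assumes fgk: "f \<in> carrier E" "g \<in> carrier E" "k \<in> carrier E"
  shows "k \<otimes>\<^bsub>E\<^esub> (f \<oplus>\<^bsub>E\<^esub> g) = k \<otimes>\<^bsub>E\<^esub> f \<oplus>\<^bsub>E\<^esub> k \<otimes>\<^bsub>E\<^esub> g"
proof (rule end_eqI)
  fix i l assume il: "i < length As" "l < length As"
  interpret abelian_group "Hom (As ! i) (As ! l)"
    using il by (intro Hom_group As_nth)
  have "(k \<otimes>\<^bsub>E\<^esub> (f \<oplus>\<^bsub>E\<^esub> g)) (i, l) = (\<Oplus>\<^bsub>Hom (As ! i) (As ! l)\<^esub>j\<in>{..<length As}.
      cmp (As ! i) (As ! j) (As ! l) (k (j, l)) (f (i, j)) \<oplus>\<^bsub>Hom (As ! i) (As ! l)\<^esub>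
      cmp (As ! i) (As ! j) (As ! l) (k (j, l)) (g (i, j)))"
    using il fgk hom_mult[OF cmp_hom_left] unfolding end_mult_apply[OF il]
    by (intro finsum_cong') (auto simp: end_add_apply As_nth end_closed cmp_closed)
  also have "\<dots> = (k \<otimes>\<^bsub>E\<^esub> f \<oplus>\<^bsub>E\<^esub> k \<otimes>\<^bsub>E\<^esub> g) (i, l)"
    using il fgk unfolding end_add_apply[OF il] end_mult_apply[OF il]
    by (intro finsum_addf) (auto simp: As_nth end_closed cmp_closed)
  finally show "(k \<otimes>\<^bsub>E\<^esub> (f \<oplus>\<^bsub>E\<^esub> g)) (i, l) = (k \<otimes>\<^bsub>E\<^esub> f \<oplus>\<^bsub>E\<^esub> k \<otimes>\<^bsub>E\<^esub> g) (i, l)" .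
qed (intro end_add_closed end_mult_closed fgk)+

lemma end_ring_is_ring: "ring E"
  by (intro ringI monoidI)
    (simp_all add: end_abelian_group end_mult_closed end_one_closed end_mult_assoc end_one_mult
      end_mult_one end_distrib_left end_distrib_right)

end

end

section \<open>Additive groups of the coefficient ring and of sections\<close>

text \<open>An oriented theory guarantees a ring structure only on members of \<open>Sm\<close>, so
  this is what makes \<open>hr h Pt\<close> a ring.\<close>

lemma Pt_in_Sm: "Pt \<in> Sm"
proof -
  have all: "zclosed base_field [] {[] :: 'a pt}"
    unfolding zclosed_def by (intro exI[of _ "{}"]) (auto simp: mproj_def)
  have one: "(1 :: 'a alg_closure) \<in> base_field"
    unfolding base_field_def by (metis rangeI to_ac_1)
  \<comment> \<open>The constant polynomial 1 is a form, since with no projective factors the degree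
    conditions are vacuous, and it has no zero.\<close>
  have none: "zclosed base_field [] ({} :: 'a pt set)"
    unfolding zclosed_def
    by (intro exI[of _ "{Poly_Mapping.single 0 1}"])
      (auto simp: form_def peval_def one)
  have "is_variety (Pt :: 'a variety)"
    unfolding is_variety_def Pt_def using all none by force
  \<comment> \<open>The point is cut out by \<open>c = 0\<close> equations, so the condition on
    gradients is vacuous.\<close>
  moreover have "smooth (Pt :: 'a variety)"
    unfolding smooth_def Pt_def
    by (auto intro!: exI[of _ 0] exI[of _ "{}"] simp: none mproj_def)
  ultimately show ?thesis by (simp add: Sm_def)
qed

text \<open>Addition is pointwise, and both finiteness conditions survive because the support of a
  sum lies in the union of the supports.\<close>

lemma series_ring_abelian_group:
  assumes "abelian_group R"
  shows "abelian_group (series_ring fin R C)"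
proof -
  interpret abelian_group R by (rule assms)
  let ?A = "series_ring fin R C"
  have closed: "f m \<in> carrier R" if "f \<in> carrier ?A" for f m
    using that by (simp add: series_ring_def)
  have add: "f \<oplus>\<^bsub>?A\<^esub> g = (\<lambda>m. f m \<oplus>\<^bsub>R\<^esub> g m)" for f g
    by (simp add: series_ring_def)
  have zero: "\<zero>\<^bsub>?A\<^esub> = (\<lambda>m. \<zero>\<^bsub>R\<^esub>)"
    by (simp add: series_ring_def)
  show ?thesis
  proof (rule abelian_groupI)
    fix f g assume fg: "f \<in> carrier ?A" "g \<in> carrier ?A"
    have supp: "{m. f m \<oplus>\<^bsub>R\<^esub> g m \<noteq> \<zero>\<^bsub>R\<^esub>} \<subseteq> {m. f m \<noteq> \<zero>\<^bsub>R\<^esub>} \<union> {m. g m \<noteq> \<zero>\<^bsub>R\<^esub>}"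
      by auto
    have "finite {m. f m \<oplus>\<^bsub>R\<^esub> g m \<noteq> \<zero>\<^bsub>R\<^esub> \<and> mono_degree m = n}" for n
    proof (rule finite_subset)
      show "{m. f m \<oplus>\<^bsub>R\<^esub> g m \<noteq> \<zero>\<^bsub>R\<^esub> \<and> mono_degree m = n} \<subseteq>
        {m. f m \<noteq> \<zero>\<^bsub>R\<^esub> \<and> mono_degree m = n} \<union> {m. g m \<noteq> \<zero>\<^bsub>R\<^esub> \<and> mono_degree m = n}"
        using supp by auto
    qed (use fg in \<open>simp add: series_ring_def\<close>)
    moreover have "finite {m. f m \<oplus>\<^bsub>R\<^esub> g m \<noteq> \<zero>\<^bsub>R\<^esub>}" if fin
      using fg that by (intro finite_subset[OF supp]) (simp add: series_ring_def)
    ultimately show "f \<oplus>\<^bsub>?A\<^esub> g \<in> carrier ?A"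
      using fg by (simp add: series_ring_def)
    show "f \<oplus>\<^bsub>?A\<^esub> g = g \<oplus>\<^bsub>?A\<^esub> f"
      unfolding add by (intro ext a_comm closed fg)
  next
    fix f g k assume "f \<in> carrier ?A" "g \<in> carrier ?A" "k \<in> carrier ?A"
    then show "f \<oplus>\<^bsub>?A\<^esub> g \<oplus>\<^bsub>?A\<^esub> k = f \<oplus>\<^bsub>?A\<^esub> (g \<oplus>\<^bsub>?A\<^esub> k)"
      unfolding add by (intro ext a_assoc closed)
  next
    fix f assume f: "f \<in> carrier ?A"
    then show "\<zero>\<^bsub>?A\<^esub> \<oplus>\<^bsub>?A\<^esub> f = f"
      unfolding add zero by (intro ext l_zero closed)
    let ?g = "\<lambda>m. \<ominus>\<^bsub>R\<^esub> f m"
    \<comment> \<open>Negation does not change the support, hence preserves both finiteness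
      conditions.\<close>
    have "?g m = \<zero>\<^bsub>R\<^esub> \<longleftrightarrow> f m = \<zero>\<^bsub>R\<^esub>" for m
      using closed[OF f] by (rule add.inv_eq_1_iff)
    then have "?g \<in> carrier ?A"
      using f by (simp add: series_ring_def)
    moreover have "?g \<oplus>\<^bsub>?A\<^esub> f = \<zero>\<^bsub>?A\<^esub>"
      unfolding add zero by (intro ext l_neg closed f)
    ultimately show "\<exists>g\<in>carrier ?A. g \<oplus>\<^bsub>?A\<^esub> f = \<zero>\<^bsub>?A\<^esub>" by blast
  qed (simp add: series_ring_def)
qed

text \<open>No ring axioms of the power series ring are used: \<open>genideal\<close> is either an intersection of
  additive subgroups or, if no ideal contains the relations, \<open>UNIV\<close>.\<close>

lemma fgl_ideal_abelian_subgroup: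
  assumes R: "abelian_group R"
  shows "abelian_subgroup (fgl_ideal fin R F M) (series_ring fin R (carrier M))"
proof -
  let ?A = "series_ring fin R (carrier M)"
  let ?J = "genideal ?A (fgl_relations fin R F M)"
  interpret A: abelian_group ?A by (rule series_ring_abelian_group[OF R])
  interpret R: abelian_group R by (rule R)
  have ideals: "additive_subgroup I ?A" if "ideal I ?A" for I
    using that by (rule ideal.axioms)
  have J_zero: "\<zero>\<^bsub>?A\<^esub> \<in> ?J"
    by (auto simp: genideal_def intro: additive_subgroup.zero_closed ideals)
  have J_add: "f \<oplus>\<^bsub>?A\<^esub> g \<in> ?J" if "f \<in> ?J" "g \<in> ?J" for f g
    using that by (auto simp: genideal_def intro: additive_subgroup.a_closed ideals)
  have J_inv: "\<ominus>\<^bsub>?A\<^esub> f \<in> ?J" if "f \<in> ?J" for f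
    using that by (auto simp: genideal_def intro!: additive_subgroup.a_inv_closed ideals A.abelian_group_axioms)
  have J_cases: "?J \<subseteq> carrier ?A \<or> ?J = UNIV"
    using additive_subgroup.a_subset[OF ideals] by (auto simp: genideal_def)
  have add: "(f \<oplus>\<^bsub>?A\<^esub> g) m = f m \<oplus>\<^bsub>R\<^esub> g m" for f g m
    by (simp add: series_ring_def)
  \<comment> \<open>The negative in \<open>?A\<close> is an abstract inverse; uniqueness of
    negatives in \<open>R\<close> shows that it is pointwise on the carrier.\<close>
  have inv: "(\<ominus>\<^bsub>?A\<^esub> f) m = \<ominus>\<^bsub>R\<^esub> f m" if f: "f \<in> carrier ?A" for f m
  proof (rule R.minus_equality[symmetric])
    show "(\<ominus>\<^bsub>?A\<^esub> f) m \<oplus>\<^bsub>R\<^esub> f m = \<zero>\<^bsub>R\<^esub>"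
      using A.l_neg[OF f] unfolding add[symmetric] by (simp add: series_ring_def)
    show "f m \<in> carrier R" "(\<ominus>\<^bsub>?A\<^esub> f) m \<in> carrier R"
      using f A.a_inv_closed[OF f] by (auto simp: series_ring_def)
  qed
  show ?thesis
  proof (intro abelian_subgroupI3 additive_subgroup.intro subgroup.intro A.abelian_group_axioms)
    show "fgl_ideal fin R F M \<subseteq> carrier (add_monoid ?A)"
      by (auto simp: fgl_ideal_def)
    show "\<one>\<^bsub>add_monoid ?A\<^esub> \<in> fgl_ideal fin R F M"
      using J_zero by (auto simp: fgl_ideal_def)
  next
    fix f g assume fg: "f \<in> fgl_ideal fin R F M" "g \<in> fgl_ideal fin R F M"
    have "\<exists>k\<in>?J. \<forall>m. mono_degree m < n \<longrightarrow> (f \<oplus>\<^bsub>?A\<^esub> g) m = k m" for n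
    proof -
      obtain f' g' where "f' \<in> ?J" "g' \<in> ?J"
        and "\<forall>m. mono_degree m < n \<longrightarrow> f m = f' m" "\<forall>m. mono_degree m < n \<longrightarrow> g m = g' m"
        using fg unfolding fgl_ideal_def by blast
      then show ?thesis
        by (intro bexI[of _ "f' \<oplus>\<^bsub>?A\<^esub> g'"] J_add) (auto simp: add)
    qed
    then show "f \<otimes>\<^bsub>add_monoid ?A\<^esub> g \<in> fgl_ideal fin R F M"
      using fg by (auto simp: fgl_ideal_def)
  next
    fix f assume f: "f \<in> fgl_ideal fin R F M"
    then have fA: "f \<in> carrier ?A" by (simp add: fgl_ideal_def)
    have "\<exists>k\<in>?J. \<forall>m. mono_degree m < n \<longrightarrow> (\<ominus>\<^bsub>?A\<^esub> f) m = k m" for n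
    \<comment> \<open>If \<open>?J\<close> is everything, the negative of \<open>f\<close>
      approximates itself. Otherwise the approximant \<open>f'\<close> lies in the carrier, where
      negation is pointwise.\<close>
    proof (cases "?J = UNIV")
      case False
      obtain f' where f': "f' \<in> ?J" "\<forall>m. mono_degree m < n \<longrightarrow> f m = f' m"
        using f unfolding fgl_ideal_def by blast
      then have "f' \<in> carrier ?A" using False J_cases by auto
      then show ?thesis
        using f' fA by (intro bexI[of _ "\<ominus>\<^bsub>?A\<^esub> f'"] J_inv) (auto simp: inv)
    qed auto
    then show "inv\<^bsub>add_monoid ?A\<^esub> f \<in> fgl_ideal fin R F M"
      using fA A.a_inv_closed[OF fA] by (auto simp: fgl_ideal_def a_inv_def)
  qed
qed

text \<open>Additively, the quotient ring is the factor group by an additive subgroup, so the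
  previous lemma suffices.\<close>

lemma formal_group_ring_abelian_group:
  assumes "abelian_group R"
  shows "abelian_group (formal_group_ring fin R F M)"
proof -
  interpret abelian_subgroup "fgl_ideal fin R F M" "series_ring fin R (carrier M)"
    by (rule fgl_ideal_abelian_subgroup[OF assms])
  show ?thesis
    unfolding formal_group_ring_def
    by (rule comm_group_abelian_groupI)
      (simp add: FactRing_def a_factorgroup_is_comm_group[unfolded A_FactGroup_def'])
qed

lemma coeff_ring_abelian_group:
  assumes "oriented_theory h"
  shows "abelian_group (coeff_ring G fin h F)"
proof -
  have "oct_pullbacks h"
    using assms by (simp add: oriented_theory_def)
  then have "\<forall>X\<in>Sm. cring (hr h X)"
    unfolding oct_pullbacks_def by (rule conjunct1)
  then have "cring (hr h Pt)"
    using Pt_in_Sm by blast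
  then show ?thesis
    unfolding coeff_ring_def by (intro formal_group_ring_abelian_group) (rule ring.is_abelian_group[OF cring.axioms(1)])
qed

text \<open>An isomorphism of additive monoids need not respect the designated zero of its target when
  the target is not known to be a monoid. As zero is the only idempotent section, it does so here.\<close>

lemma sections_idempotent:
  assumes "oriented_theory h" and c: "c \<in> carrier (sections G fin h F l Q P)"
    and idem: "c \<oplus>\<^bsub>sections G fin h F l Q P\<^esub> c = c"
  shows "c = \<zero>\<^bsub>sections G fin h F l Q P\<^esub>"
proof -
  interpret S: abelian_group "coeff_ring G fin h F"
    by (rule coeff_ring_abelian_group) fact
  have ext: "c \<in> min_reps G Q P \<rightarrow>\<^sub>E carrier (coeff_ring G fin h F)"
    using c by (simp add: sections_def Let_def)
  have "c u = \<zero>\<^bsub>coeff_ring G fin h F\<^esub>" if u: "u \<in> min_reps G Q P" for u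
  proof -
    have "c u \<oplus>\<^bsub>coeff_ring G fin h F\<^esub> c u = c u"
      using fun_cong[OF idem, of u] u by (simp add: sections_def Let_def)
    then show ?thesis
      using PiE_mem[OF ext u] by (simp add: S.add.l_cancel_one)
  qed
  then show ?thesis
    using ext by (intro extensionalityI[where A = "min_reps G Q P"]) (auto simp: sections_def Let_def PiE_iff)
qed

text \<open>Closure of sections under addition and negatives is inherited from \<open>A\<close>,
  without revisiting the invariance and divisibility conditions. The image of zero is idempotent,
  hence the declared zero.\<close>

lemma sections_abelian_group:
  assumes "oriented_theory h" and A: "abelian_group A"
    and f: "f \<in> iso (add_monoid A) (add_monoid (sections G fin h F l Q P))"
  shows "abelian_group (sections G fin h F l Q P)"
proof (rule iso_abelian_group[OF A f])
  interpret A: abelian_group A by (rule A)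
  have hom: "f \<in> hom (add_monoid A) (add_monoid (sections G fin h F l Q P))"
    using f by (simp add: iso_def)
  show "f \<zero>\<^bsub>A\<^esub> = \<zero>\<^bsub>sections G fin h F l Q P\<^esub>"
    using hom_in_carrier[OF hom, of "\<zero>\<^bsub>A\<^esub>"] hom_mult[OF hom, of "\<zero>\<^bsub>A\<^esub>" "\<zero>\<^bsub>A\<^esub>"]
    by (intro sections_idempotent assms) simp_all
qed

section \<open>Entrywise localization as a ring isomorphism\<close>

theorem corollary7p5:
  fixes G :: "'k::field_char_0 alg_group"
    and \<U> :: "'k rep_system"
    and h :: "('k, 'x) oct"
    and F :: "nat \<Rightarrow> nat \<Rightarrow> 'x"
    and fin :: bool
    and l :: "'k labelling"
    and Ps :: "'k pt set list"
  assumes "split_semisimple G" and "type_A G"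
    and "good_system G \<U>"
    and "oriented_theory h" and "formal_group_law h F" and "free_theory h F"
    and "chern_complete G \<U> fin h F" and "sigma_regular G fin h F"
    and "is_labelling G l"
    and "distinct Ps" and "set Ps = parabolics G"
    and motives: "preadditive_category (parabolics G) (motive_hom G \<U> h) (corr_comp G \<U> h) (corr_id G \<U> h)"
    and identification: "\<And>Q P. Q \<in> parabolics G \<Longrightarrow> P \<in> parabolics G \<Longrightarrow>
      localize G \<U> fin h F Q P \<in>
        iso (add_monoid (hTW G \<U> h (flag2 G Q P))) (add_monoid (sections G fin h F l Q P))"
  shows "ring (total_sections G \<U> fin h F l) \<and> ring (motive_end G \<U> h Ps) \<and>
    total_sections G \<U> fin h F l \<simeq> motive_end G \<U> h Ps"
proof -
  let ?\<P> = "parabolics G"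
  let ?\<Gamma> = "sections G fin h F l"
  let ?loc = "localize G \<U> fin h F"
  let ?T = "total_sections G \<U> fin h F l"
  let ?E = "motive_end G \<U> h Ps"
  interpret preadditive ?\<P> "motive_hom G \<U> h" "corr_comp G \<U> h" "corr_id G \<U> h"
    by unfold_locales (rule motives)
  have Ps: "set Ps \<subseteq> ?\<P>" by (simp add: assms)
  have ringE: "ring ?E"
    unfolding motive_end_def by (rule end_ring_is_ring[OF Ps])
  \<comment> \<open>The product of \<open>?T\<close> is a \<open>finsum\<close> in these structures,
    which can be manipulated only once they are known to be groups.\<close>
  have \<Gamma>: "abelian_group (?\<Gamma> Q P)" if "Q \<in> ?\<P>" "P \<in> ?\<P>" for Q P
    using sections_abelian_group[OF \<open>oriented_theory h\<close> Hom_group[OF that, unfolded motive_hom_def]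
        identification[OF that]] .
  have hom: "?loc Q P \<in> hom (add_monoid (motive_hom G \<U> h Q P)) (add_monoid (?\<Gamma> Q P))"
    and bij: "bij_betw (?loc Q P) (carrier (motive_hom G \<U> h Q P)) (carrier (?\<Gamma> Q P))"
    if "Q \<in> ?\<P>" "P \<in> ?\<P>" for Q P
    using identification[OF that] by (simp_all add: motive_hom_def iso_def)
  define ix where "ix = inv_into {..<length Ps} ((!) Ps)"
  have nth: "bij_betw ((!) Ps) {..<length Ps} ?\<P>"
    using bij_betw_nth[OF \<open>distinct Ps\<close> refl \<open>set Ps = ?\<P>\<close>[symmetric]] .
  have ix: "bij_betw ix ?\<P> {..<length Ps}"
    unfolding ix_def by (rule bij_betw_inv_into[OF nth])
  have ix_less: "ix P < length Ps" and nth_ix: "Ps ! ix P = P" if "P \<in> ?\<P>" for P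
    using bij_betwE[OF ix] bij_betw_inv_into_right[OF nth that] that by (auto simp: ix_def)
  have ix_nth: "ix (Ps ! i) = i" if "i < length Ps" for i
    using bij_betw_inv_into_left[OF nth] that by (simp add: ix_def)
  \<comment> \<open>The map starts at the matrices, opposite to the isomorphism claimed: only
    \<open>?E\<close> is known to be a ring so far, and the axioms of \<open>?T\<close> are to be
    obtained as those of its image.\<close>
  define \<Psi> where "\<Psi> = (\<lambda>f. \<lambda>(Q, P)\<in>?\<P> \<times> ?\<P>. ?loc Q P (f (ix Q, ix P)))"
  note closed = end_closed[OF Ps, folded motive_end_def]
  have f_closed: "f (ix Q, ix P) \<in> carrier (motive_hom G \<U> h Q P)"
    if "f \<in> carrier ?E" "Q \<in> ?\<P>" "P \<in> ?\<P>" for f Q P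
    using closed[OF that(1) ix_less ix_less, OF that(2,3)] that by (simp add: nth_ix)
  \<comment> \<open>This makes \<open>section_comp\<close> of localized classes the localization of
    their \<open>corr_comp\<close>, the heart of multiplicativity.\<close>
  have unloc: "unlocalize G \<U> fin h F Q P (?loc Q P a) = a"
    if "Q \<in> ?\<P>" "P \<in> ?\<P>" "a \<in> carrier (motive_hom G \<U> h Q P)" for Q P a
    unfolding unlocalize_def using bij_betw_inv_into_left[OF bij] that by simp
  have \<Psi>_apply: "\<Psi> f (Q, P) = ?loc Q P (f (ix Q, ix P))" if "Q \<in> ?\<P>" "P \<in> ?\<P>" for f Q P
    using that by (simp add: \<Psi>_def)
  have "bij_betw \<Psi> (carrier ?E) (carrier ?T)"
  proof -
    have "bij_betw (map_prod ix ix) (?\<P> \<times> ?\<P>) ({..<length Ps} \<times> {..<length Ps})"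
      using ix ix by (rule bij_betw_map_prod)
    then have "bij_betw (\<lambda>f. \<lambda>x\<in>?\<P> \<times> ?\<P>. ?loc (fst x) (snd x) (f (map_prod ix ix x)))
      (\<Pi>\<^sub>E x\<in>{..<length Ps} \<times> {..<length Ps}. carrier (motive_hom G \<U> h (Ps ! fst x) (Ps ! snd x)))
      (\<Pi>\<^sub>E x\<in>?\<P> \<times> ?\<P>. carrier (?\<Gamma> (fst x) (snd x)))"
      by (rule bij_betw_PiE) (auto simp: nth_ix bij)
    then show ?thesis
      unfolding \<Psi>_def motive_end_def end_ring_def mat_hom_def total_sections_def Let_def
      by (simp add: case_prod_unfold map_prod_def)
  qed
  moreover have "\<Psi> (g \<otimes>\<^bsub>?E\<^esub> f) = \<Psi> g \<otimes>\<^bsub>?T\<^esub> \<Psi> f" if g: "g \<in> carrier ?E" and f: "f \<in> carrier ?E" for g f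
  proof (rule extensionalityI[where A = "?\<P> \<times> ?\<P>"])
    fix x assume "x \<in> ?\<P> \<times> ?\<P>"
    then obtain Q H where x: "x = (Q, H)" and QH: "Q \<in> ?\<P>" "H \<in> ?\<P>" by auto
    interpret M: abelian_group "motive_hom G \<U> h Q H" by (rule Hom_group[OF QH])
    interpret \<Gamma>: abelian_group "?\<Gamma> Q H" by (rule \<Gamma>[OF QH])
    let ?c = "\<lambda>P. corr_comp G \<U> h Q P H (g (ix P, ix H)) (f (ix Q, ix P))"
    have c: "?c \<in> ?\<P> \<rightarrow> carrier (motive_hom G \<U> h Q H)"
      using QH by (auto intro!: cmp_closed f_closed[OF f] f_closed[OF g])
    have "(g \<otimes>\<^bsub>?E\<^esub> f) (ix Q, ix H) = (\<Oplus>\<^bsub>motive_hom G \<U> h Q H\<^esub>j\<in>{..<length Ps}.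
        corr_comp G \<U> h Q (Ps ! j) H (g (j, ix H)) (f (ix Q, j)))"
      using end_mult_apply[OF Ps ix_less ix_less, OF QH] QH
      by (simp add: motive_end_def nth_ix)
    also have "\<dots> = (\<Oplus>\<^bsub>motive_hom G \<U> h Q H\<^esub>j\<in>{..<length Ps}. ?c (Ps ! j))"
      using bij_betwE[OF nth] c by (intro M.finsum_cong') (auto simp: ix_nth)
    also have "\<dots> = (\<Oplus>\<^bsub>motive_hom G \<U> h Q H\<^esub>P\<in>?\<P>. ?c P)"
      using nth c M.finsum_reindex[of ?c "(!) Ps" "{..<length Ps}"] by (simp add: bij_betw_def)
    finally have "\<Psi> (g \<otimes>\<^bsub>?E\<^esub> f) (Q, H) = (\<Oplus>\<^bsub>?\<Gamma> Q H\<^esub>P\<in>?\<P>. ?loc Q H (?c P))"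
      using additive_hom_finsum[OF M.abelian_group_axioms \<Gamma>.abelian_group_axioms hom[OF QH] c]
      by (simp add: \<Psi>_apply QH)
    also have "\<dots> = (\<Oplus>\<^bsub>?\<Gamma> Q H\<^esub>P\<in>?\<P>. section_comp G \<U> fin h F Q P H (\<Psi> g (P, H)) (\<Psi> f (Q, P)))"
      using QH f g bij_betwE[OF bij[OF QH]] c
      by (intro \<Gamma>.finsum_cong') (auto simp: section_comp_def \<Psi>_apply unloc f_closed Pi_iff)
    also have "\<dots> = (\<Psi> g \<otimes>\<^bsub>?T\<^esub> \<Psi> f) (Q, H)"
      using QH by (simp add: total_sections_def Let_def)
    finally show "\<Psi> (g \<otimes>\<^bsub>?E\<^esub> f) x = (\<Psi> g \<otimes>\<^bsub>?T\<^esub> \<Psi> f) x" by (simp add: x)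
  qed (simp_all add: \<Psi>_def total_sections_def Let_def)
  moreover have "\<Psi> (f \<oplus>\<^bsub>?E\<^esub> g) = \<Psi> f \<oplus>\<^bsub>?T\<^esub> \<Psi> g" if "f \<in> carrier ?E" "g \<in> carrier ?E" for f g
  proof (rule extensionalityI[where A = "?\<P> \<times> ?\<P>"])
    fix x assume "x \<in> ?\<P> \<times> ?\<P>"
    then obtain Q P where x: "x = (Q, P)" and QP: "Q \<in> ?\<P>" "P \<in> ?\<P>" by auto
    show "\<Psi> (f \<oplus>\<^bsub>?E\<^esub> g) x = (\<Psi> f \<oplus>\<^bsub>?T\<^esub> \<Psi> g) x"
      using end_add_apply[OF Ps ix_less ix_less, OF QP] hom_mult[OF hom[OF QP]] f_closed that QP
      by (simp add: x \<Psi>_apply motive_end_def total_sections_def Let_def nth_ix)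
  qed (simp_all add: \<Psi>_def total_sections_def Let_def)
  \<comment> \<open>A \<open>ring_iso\<close> constrains one but not zero. The ring transported
    along it has zero \<open>\<Psi> \<zero>\<close>, which must be matched with the zero that
    \<open>?T\<close> declares.\<close>
  moreover have "\<Psi> \<zero>\<^bsub>?E\<^esub> = \<zero>\<^bsub>?T\<^esub>"
  proof (rule extensionalityI[where A = "?\<P> \<times> ?\<P>"])
    fix x assume "x \<in> ?\<P> \<times> ?\<P>"
    then obtain Q P where x: "x = (Q, P)" and QP: "Q \<in> ?\<P>" "P \<in> ?\<P>" by auto
    show "\<Psi> \<zero>\<^bsub>?E\<^esub> x = \<zero>\<^bsub>?T\<^esub> x"
      using end_zero_apply[OF Ps ix_less ix_less, OF QP]
        additive_hom_zero[OF Hom_group[OF QP] \<Gamma>[OF QP] hom[OF QP]] QP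
      by (simp add: x \<Psi>_apply motive_end_def total_sections_def Let_def nth_ix)
  qed (simp_all add: \<Psi>_def total_sections_def Let_def)
  moreover have "\<Psi> \<one>\<^bsub>?E\<^esub> = \<one>\<^bsub>?T\<^esub>"
  proof (rule extensionalityI[where A = "?\<P> \<times> ?\<P>"])
    fix x assume "x \<in> ?\<P> \<times> ?\<P>"
    then obtain Q P where x: "x = (Q, P)" and QP: "Q \<in> ?\<P>" "P \<in> ?\<P>" by auto
    \<comment> \<open>Diagonal positions of the matrix correspond exactly to the pairs with
      \<open>Q = P\<close>, as the two units require.\<close>
    have "ix Q = ix P \<longleftrightarrow> Q = P"
      using QP nth_ix by metis
    then show "\<Psi> \<one>\<^bsub>?E\<^esub> x = \<one>\<^bsub>?T\<^esub> x"
      using end_one_apply[OF Ps ix_less ix_less, OF QP]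
        additive_hom_zero[OF Hom_group[OF QP] \<Gamma>[OF QP] hom[OF QP]] QP
      by (simp add: x \<Psi>_apply motive_end_def total_sections_def Let_def nth_ix)
  qed (simp_all add: \<Psi>_def total_sections_def Let_def)
  ultimately have iso: "\<Psi> \<in> ring_iso ?E ?T" and zero: "\<Psi> \<zero>\<^bsub>?E\<^esub> = \<zero>\<^bsub>?T\<^esub>"
    by (auto intro!: ring_iso_memI dest: bij_betwE)
  have "ring ?T"
    using ring.ring_iso_imp_img_ring[OF ringE iso] by (simp add: zero)
  moreover have "?T \<simeq> ?E"
    using ring_iso_sym[OF ringE] iso by (auto simp: is_ring_iso_def)
  ultimately show ?thesis using ringE by blast
qed

end
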